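(* Let $q$ be a fixed odd prime power, and let $i_{Sp}(2n,q)$ be the number of involutions in $Sp(2n,q)$. (1) As $n\to\infty$ through even integers, $$\lim_{n \rightarrow \infty} \frac{i_{Sp}(2n,q)}{q^{n^2}} = \frac{1}{2} \left[ \prod_{i \geq 1} \left(1+\frac{1}{q^{2i-1}}\right)^2 + \prod_{i \geq 1} \left(1-\frac{1}{q^{2i-1}}\right)^2 \right] = \prod_{i\ge 1} \frac{(1+q^{4-8i})^2(1-q^{-8i})}{(1-q^{-2i})}.$$ (2) As $n\to\infty$ through odd integers, $$\lim_{n \rightarrow \infty} \frac{i_{Sp}(2n,q)}{q^{n^2-1}} = \frac{q}{2} \left[ \prod_{i \geq 1} \left(1+\frac{1}{q^{2i-1}}\right)^2 - \prod_{i \geq 1} \left(1-\frac{1}{q^{2i-1}}\right)^2 \right] = 2 \prod_{i\ge 1} \frac{(1+q^{-8i})(1-q^{-16i})}{(1-q^{-2i})}.$$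
   Context: $Sp(2n,q)$ is the symplectic group of a nondegenerate alternating bilinear form on the $2n$-dimensional vector space over the finite field with $q$ elements. "Involution" means an element $g$ with $g^2=1$ (the identity is counted). *)

theory Defs
  imports
    "HOL-Analysis.Infinite_Products"
    "HOL-Number_Theory.Prime_Powers"
    "Jordan_Normal_Form.Matrix"
begin

text \<open>
  Forms on \<open>F\<^sup>d\<close> are functions on coordinate vectors; only their values on
  \<^term>\<open>carrier_vec d\<close> matter.
\<close>

definition bilinear_form :: "nat \<Rightarrow> ('a::field Matrix.vec \<Rightarrow> 'a Matrix.vec \<Rightarrow> 'a) \<Rightarrow> bool" where
  "bilinear_form d B \<longleftrightarrow>
     (\<forall>u\<in>carrier_vec d. \<forall>v\<in>carrier_vec d. \<forall>w\<in>carrier_vec d.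
        B (u + v) w = B u w + B v w \<and> B w (u + v) = B w u + B w v) \<and>
     (\<forall>c. \<forall>v\<in>carrier_vec d. \<forall>w\<in>carrier_vec d.
        B (c \<cdot>\<^sub>v v) w = c * B v w \<and> B v (c \<cdot>\<^sub>v w) = c * B v w)"

definition alternating_form :: "nat \<Rightarrow> ('a::field Matrix.vec \<Rightarrow> 'a Matrix.vec \<Rightarrow> 'a) \<Rightarrow> bool" where
  "alternating_form d B \<longleftrightarrow> (\<forall>v\<in>carrier_vec d. B v v = 0)"

text \<open>
  Only one of the two radicals is required to vanish; for alternating forms they coincide.
\<close>

definition nondegenerate_form :: "nat \<Rightarrow> ('a::field Matrix.vec \<Rightarrow> 'a Matrix.vec \<Rightarrow> 'a) \<Rightarrow> bool" where
  "nondegenerate_form d B \<longleftrightarrow>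
     (\<forall>v\<in>carrier_vec d. (\<forall>w\<in>carrier_vec d. B v w = 0) \<longrightarrow> v = 0\<^sub>v d)"

definition symplectic_form :: "nat \<Rightarrow> ('a::field Matrix.vec \<Rightarrow> 'a Matrix.vec \<Rightarrow> 'a) \<Rightarrow> bool" where
  "symplectic_form d B \<longleftrightarrow> bilinear_form d B \<and> alternating_form d B \<and> nondegenerate_form d B"

definition Sp :: "nat \<Rightarrow> ('a::field Matrix.vec \<Rightarrow> 'a Matrix.vec \<Rightarrow> 'a) \<Rightarrow> 'a mat set" where
  "Sp d B = {g \<in> carrier_mat d d. invertible_mat g \<and>
     (\<forall>v\<in>carrier_vec d. \<forall>w\<in>carrier_vec d. B (g *\<^sub>v v) (g *\<^sub>v w) = B v w)}"

text \<open>The identity counts as an involution.\<close>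

definition i_Sp :: "nat \<Rightarrow> ('a::field Matrix.vec \<Rightarrow> 'a Matrix.vec \<Rightarrow> 'a) \<Rightarrow> nat" where
  "i_Sp d B = card {g \<in> Sp d B. g * g = 1\<^sub>m d}"

end

(*
Since q is odd, an involution is determined by its (-1)-eigenspace, and the subspaces that occur are
exactly the nondegenerate ones. Double counting hyperbolic pairs (e, f), B e f = 1, shows that with
x = 1/q there are q^(4k(n-k)) [n,k] nondegenerate subspaces of dimension 2k, where [n,k] is the
Gaussian binomial coefficient with base x^2. Hence i_Sp(2n,q) / q^(n^2) is the sum of x^((n-2k)^2) [n,k]
over k. By dominated convergence it tends to a theta series over the even or the odd integers, divided
by the product of the 1 - x^(2i). The Jacobi triple product, itself the limit of the q-binomial theorem
under the same dominated convergence, turns these theta series into the stated products.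
*)

theory Submission
  imports
    Defs
    "HOL-Library.Function_Algebras"
    "HOL-Number_Theory.Residues"
    "HOL-Analysis.Infinite_Set_Sum"
begin

section \<open>The Jacobi triple product\<close>

text \<open>The powers of q fit together because n^2 - 4k(n-k) = (n-2k)^2. For n = 2m + r,
  recentring at j = k - m turns the exponent of x into 4j^2 if r = 0, and into 4j^2 - 4j if r = 1
  and q^(n^2-1) is divided out. Then m enters a summand only through its Gaussian binomial, which is
  bounded by 1 / \<open>qpoch_inf x\<close>^2 throughout and tends to 1 / \<open>qpoch_inf x\<close>
  for fixed j. Dominated convergence needs no more than this, both for the count and for the triple
  product. A hyperbolic pair lies in as many nondegenerate subspaces of dimension 2k + 2 as its
  orthogonal complement has of dimension 2k. One double count therefore lowers both dimensions by
  two, and the count becomes a recursion in which n - k stays fixed. Spaces are subsets of a single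
  additive group, so that passing to a complement stays within one type.\<close>

definition qpoch :: "real \<Rightarrow> nat \<Rightarrow> real" where
  "qpoch x n = (\<Prod>i<n. 1 - x ^ (2 * Suc i))"

definition qpoch_inf :: "real \<Rightarrow> real" where
  "qpoch_inf x = (\<Prod>i. 1 - x ^ (2 * Suc i))"

text \<open>\<open>qpoch x n\<close> is the q-Pochhammer symbol (p; p)_n with p = x^2. The value 0
  for k > n keeps the Pascal rule valid at the top index and lets sums run past n.\<close>

definition qbinom :: "real \<Rightarrow> nat \<Rightarrow> nat \<Rightarrow> real" where
  "qbinom x n k = (if k \<le> n then qpoch x n / (qpoch x k * qpoch x (n - k)) else 0)"

lemma convergent_prod_power:
  fixes x c :: real
  assumes "\<bar>x\<bar> < 1" "0 < a"
  shows "convergent_prod (\<lambda>i. 1 + c * x ^ (a * i + b))"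
proof -
  have x: "norm (\<bar>x\<bar> ^ a) < 1" using assms power_strict_mono[of "\<bar>x\<bar>" 1 a] by simp
  have "summable (\<lambda>i. \<bar>c\<bar> * \<bar>x\<bar> ^ b * \<bar>x\<bar> ^ (a * i))"
    unfolding power_mult using x by (intro summable_mult summable_geometric)
  then have "summable (\<lambda>i. norm (1 + c * x ^ (a * i + b) - 1))"
    by (simp add: abs_mult power_abs power_add mult_ac)
  then show ?thesis
    using abs_convergent_prod_conv_summable abs_convergent_prod_imp_convergent_prod by blast
qed

lemma convergent_prod_LIMSEQ_lessThan:
  fixes f :: "nat \<Rightarrow> real"
  shows "convergent_prod f \<Longrightarrow> (\<lambda>n. \<Prod>i<n. f i) \<longlonglongrightarrow> prodinf f"
  using convergent_prod_LIMSEQ LIMSEQ_lessThan_iff_atMost by blast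

context
  fixes x :: real
  assumes x: "0 < x" "x < 1"
begin

lemma qpoch_factor: "0 < 1 - x ^ (2 * Suc i)" "1 - x ^ (2 * Suc i) \<le> 1"
  using x power_strict_mono[of x 1 "2 * Suc i"] zero_le_power[of x "2 * Suc i"] by auto

lemma qpoch_pos: "0 < qpoch x n"
  unfolding qpoch_def by (intro prod_pos) (use qpoch_factor in blast)

lemma qpoch_le_1: "qpoch x n \<le> 1"
  unfolding qpoch_def by (intro prod_le_1) (use qpoch_factor in \<open>auto intro: less_imp_le\<close>)

lemma convergent_qpoch: "convergent_prod (\<lambda>i. 1 - x ^ (2 * Suc i))"
  using convergent_prod_power[of x 2 "-1" 2] x by (simp add: add.commute)

lemma qpoch_LIMSEQ: "qpoch x \<longlonglongrightarrow> qpoch_inf x"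
  using convergent_prod_LIMSEQ_lessThan[OF convergent_qpoch]
  unfolding qpoch_inf_def qpoch_def[abs_def] .

lemma qpoch_inf_pos: "0 < qpoch_inf x"
  unfolding qpoch_inf_def by (rule less_0_prodinf[OF convergent_qpoch]) (rule qpoch_factor)

text \<open>Every factor is at most 1, so the partial products decrease to their limit. This gives
  the positive lower bound for the denominators of the Gaussian binomials.\<close>

lemma qpoch_inf_le: "qpoch_inf x \<le> qpoch x n"
proof -
  have "decseq (qpoch x)"
    unfolding decseq_Suc_iff
  proof
    fix n show "qpoch x (Suc n) \<le> qpoch x n"
      using mult_left_mono[OF qpoch_factor(2)[of n] less_imp_le[OF qpoch_pos[of n]]]
      by (simp add: qpoch_def)
  qed
  then show ?thesis using qpoch_LIMSEQ by (rule decseq_ge)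
qed

lemma qpoch_Suc: "qpoch x (Suc n) = qpoch x n * (1 - x ^ (2 * Suc n))"
  by (simp add: qpoch_def)

lemma qbinom_0: "qbinom x n 0 = 1" and qbinom_refl: "qbinom x n n = 1"
  using qpoch_pos[of n] by (simp_all add: qbinom_def qpoch_def[of _ 0])

text \<open>With p = x^2, u = p^(k+1) and v = p^(n-k), this is 1 - uv = (1 - v) + v(1 - u) over a
  common denominator. Of the two q-Pascal rules, this one matches multiplication by the last factor
  1 + t x^(2n).\<close>

lemma qbinom_Suc_Suc:
  assumes "k \<le> n"
  shows "qbinom x (Suc n) (Suc k) = qbinom x n (Suc k) + x ^ (2 * (n - k)) * qbinom x n k"
proof (cases "k = n")
  case True
  then show ?thesis by (simp add: qbinom_refl) (simp add: qbinom_def)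
next
  case False
  \<comment> \<open>For k < n both k + 1 and n - k are successors, so a factor can be split off
    either Pochhammer symbol in the denominator.\<close>
  then obtain d where n: "n = Suc (k + d)"
    using assms by (metis add_Suc_right less_imp_Suc_add nat_less_le)
  have pk: "qpoch x k \<noteq> 0" "qpoch x d \<noteq> 0" "qpoch x n \<noteq> 0" using qpoch_pos by (metis less_irrefl)+
  have f: "1 - x ^ (2 * Suc k) \<noteq> 0" "1 - x ^ (2 * Suc d) \<noteq> 0"
    using qpoch_factor(1) by (metis less_irrefl)+
  have gen: "P * (1 - u * v) / (a * (1 - u) * (b * (1 - v))) = P / (a * (1 - u) * b) + v * (P / (a * (b * (1 - v))))"
    if "a \<noteq> 0" "b \<noteq> 0" "1 - u \<noteq> 0" "1 - v \<noteq> 0" for P a b u v :: real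
    using that by (simp add: divide_simps) (simp add: algebra_simps)
  have pw: "x ^ (2 * Suc n) = x ^ (2 * Suc k) * x ^ (2 * Suc d)"
    by (simp add: n flip: power_add)
  have "qbinom x (Suc n) (Suc k)
      = qpoch x n * (1 - x ^ (2 * Suc k) * x ^ (2 * Suc d))
        / (qpoch x k * (1 - x ^ (2 * Suc k)) * (qpoch x d * (1 - x ^ (2 * Suc d))))"
    unfolding qbinom_def pw[symmetric] qpoch_Suc[symmetric] by (simp add: n)
  also have "\<dots> = qpoch x n / (qpoch x k * (1 - x ^ (2 * Suc k)) * qpoch x d)
        + x ^ (2 * Suc d) * (qpoch x n / (qpoch x k * (qpoch x d * (1 - x ^ (2 * Suc d)))))"
    by (rule gen[OF pk(1,2) f])
  also have "\<dots> = qbinom x n (Suc k) + x ^ (2 * (n - k)) * qbinom x n k"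
    unfolding qbinom_def qpoch_Suc[symmetric] by (simp add: n)
  finally show ?thesis .
qed

lemma q_binomial_theorem:
  "(\<Prod>i<n. 1 + t * x ^ (2 * i)) = (\<Sum>k\<le>n. x ^ (k * (k - 1)) * qbinom x n k * t ^ k)"
proof (induction n)
  case 0
  show ?case by (simp add: qbinom_0)
next
  case (Suc n)
  let ?b = "\<lambda>k. x ^ (k * (k - 1)) * qbinom x n k * t ^ k"
  have "(\<Sum>k\<le>Suc n. x ^ (k * (k - 1)) * qbinom x (Suc n) k * t ^ k)
      = 1 + (\<Sum>k\<le>n. x ^ (Suc k * k) * qbinom x (Suc n) (Suc k) * t ^ Suc k)"
    by (subst sum.atMost_Suc_shift) (simp add: qbinom_0)
  also have "(\<Sum>k\<le>n. x ^ (Suc k * k) * qbinom x (Suc n) (Suc k) * t ^ Suc k)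
      = (\<Sum>k\<le>n. ?b (Suc k) + t * x ^ (2 * n) * ?b k)"
  proof (rule sum.cong)
    fix k assume "k \<in> {..n}"
    then have k: "k \<le> n" by simp
    \<comment> \<open>Exponent balance: the Pascal weight at k + 1 becomes the x^(2n) of the new
      factor.\<close>
    have "Suc k * k + 2 * (n - k) = 2 * n + k * (k - 1)"
      using k by (cases k) (auto simp: algebra_simps)
    then have pw: "x ^ (Suc k * k) * x ^ (2 * (n - k)) = x ^ (2 * n) * x ^ (k * (k - 1))"
      by (metis power_add)
    have gen: "a * (b + y * g) * (t * u) = a * b * (t * u) + t * w * (d * g * u)"
      if "a * y = w * d" for a b d g u w y :: real
    proof -
      have "a * (b + y * g) * (t * u) = a * b * (t * u) + (a * y) * (g * t * u)"
        by (simp add: algebra_simps)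
      then show ?thesis unfolding that by (simp add: algebra_simps)
    qed
    show "x ^ (Suc k * k) * qbinom x (Suc n) (Suc k) * t ^ Suc k = ?b (Suc k) + t * x ^ (2 * n) * ?b k"
      unfolding qbinom_Suc_Suc[OF k] diff_Suc_1 power_Suc[of t] by (rule gen[OF pw])
  qed simp
  also have "1 + (\<Sum>k\<le>n. ?b (Suc k) + t * x ^ (2 * n) * ?b k)
      = (1 + (\<Sum>k\<le>n. ?b (Suc k))) + t * x ^ (2 * n) * (\<Sum>k\<le>n. ?b k)"
    by (simp add: sum.distrib sum_distrib_left)
  also have "1 + (\<Sum>k\<le>n. ?b (Suc k)) = (\<Sum>k\<le>Suc n. ?b k)"
    by (subst sum.atMost_Suc_shift) (simp add: qbinom_0)
  also have "\<dots> = (\<Sum>k\<le>n. ?b k)" by (simp add: qbinom_def)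
  finally show ?case using Suc.IH by (simp add: algebra_simps)
qed

text \<open>The q-binomial theorem with 2n factors, where t = z x^(1-2n) makes the exponents of x
  symmetric: they run from -(2n-1) to 2n-1 in steps of 2. Turning over the factors with negative
  exponent costs z^n / x^(n^2), and this constant recentres the sum at k = n.\<close>

lemma finite_jacobi_triple_product:
  assumes z: "z \<noteq> 0"
  shows "(\<Prod>i<n. (1 + z * x ^ (2 * i + 1)) * (1 + x ^ (2 * i + 1) / z))
    = (\<Sum>k\<le>2 * n. x powi ((int k - int n)\<^sup>2) * z powi (int k - int n) * qbinom x (2 * n) k)"
proof -
  define t where "t = z * x powi (1 - 2 * int n)"
  have x0: "x \<noteq> 0" using x by simp
  have odd_sum: "(\<Prod>i<n. x ^ (2 * i + 1)) = x ^ n\<^sup>2"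
  proof (induction n)
    case (Suc n)
    have "n\<^sup>2 + (2 * n + 1) = (Suc n)\<^sup>2" by (simp add: power2_eq_square)
    then show ?case unfolding prod.lessThan_Suc Suc.IH by (metis power_add)
  qed simp
  have upper: "1 + t * x ^ (2 * (n + i)) = 1 + z * x ^ (2 * i + 1)" for i
  proof -
    have "x powi (1 - 2 * int n) * x ^ (2 * (n + i)) = x powi ((1 - 2 * int n) + int (2 * (n + i)))"
      using x0 by (simp only: power_int_add power_int_of_nat disj_not1 simp_thms)
    also have "(1 - 2 * int n) + int (2 * (n + i)) = int (2 * i + 1)" by simp
    finally show ?thesis unfolding t_def power_int_of_nat by (simp only: mult.assoc)
  qed
  have lower: "1 + t * x ^ (2 * (n - Suc i)) = (1 + x ^ (2 * i + 1) / z) * (z / x ^ (2 * i + 1))" if "i < n" for i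
  proof -
    have "x powi (1 - 2 * int n) * x ^ (2 * (n - Suc i)) = x powi ((1 - 2 * int n) + int (2 * (n - Suc i)))"
      using x0 by (simp only: power_int_add power_int_of_nat disj_not1 simp_thms)
    also have "(1 - 2 * int n) + int (2 * (n - Suc i)) = - int (2 * i + 1)" using that by simp
    finally have "t * x ^ (2 * (n - Suc i)) = z / x ^ (2 * i + 1)"
      unfolding t_def power_int_minus power_int_of_nat by (simp only: mult.assoc divide_inverse)
    then show ?thesis using x0 z by (simp add: field_simps)
  qed
  have "(\<Prod>i<2 * n. 1 + t * x ^ (2 * i)) = (\<Prod>i<n. 1 + t * x ^ (2 * i)) * (\<Prod>i<n. 1 + t * x ^ (2 * (n + i)))"
  proof -
    have "(\<Prod>i<n + k. f i) = (\<Prod>i<n. f i) * (\<Prod>i<k. f (n + i))" for f :: "nat \<Rightarrow> real" and k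
      by (induction k) (simp_all add: mult.assoc)
    then show ?thesis unfolding mult_2[of n] .
  qed
  also have "(\<Prod>i<n. 1 + t * x ^ (2 * i)) = (\<Prod>i<n. (1 + x ^ (2 * i + 1) / z) * (z / x ^ (2 * i + 1)))"
    by (subst prod.nat_diff_reindex[symmetric]) (intro prod.cong refl lower, simp)
  also have "\<dots> = (\<Prod>i<n. 1 + x ^ (2 * i + 1) / z) * (z ^ n / x ^ n\<^sup>2)"
    unfolding prod.distrib prod_dividef odd_sum by simp
  also have "(\<Prod>i<n. 1 + t * x ^ (2 * (n + i))) = (\<Prod>i<n. 1 + z * x ^ (2 * i + 1))"
    using upper by simp
  finally have "(\<Prod>i<n. (1 + z * x ^ (2 * i + 1)) * (1 + x ^ (2 * i + 1) / z))
      = x ^ n\<^sup>2 / z ^ n * (\<Sum>k\<le>2 * n. x ^ (k * (k - 1)) * qbinom x (2 * n) k * t ^ k)"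
    unfolding q_binomial_theorem prod.distrib using x0 z by simp
  also have "\<dots> = (\<Sum>k\<le>2 * n. x powi ((int k - int n)\<^sup>2) * z powi (int k - int n) * qbinom x (2 * n) k)"
    unfolding sum_distrib_left
  proof (rule sum.cong)
    fix k :: nat
    \<comment> \<open>Completing the square: n^2 comes from the turned factors, k(k-1) from the
      q-binomial theorem and (1-2n)k from t^k.\<close>
    have e: "int (n\<^sup>2) + int (k * (k - 1)) + (1 - 2 * int n) * int k = (int k - int n)\<^sup>2"
      by (cases k) (simp_all add: power2_eq_square algebra_simps)
    have "x powi ((int k - int n)\<^sup>2) = x ^ n\<^sup>2 * x ^ (k * (k - 1)) * (x powi (1 - 2 * int n)) ^ k"
      unfolding e[symmetric] power_int_add[OF disjI1[OF x0]] power_int_of_nat power_int_mult ..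
    moreover have "z powi (int k - int n) = z ^ k / z ^ n"
      using z by (simp add: power_int_diff)
    ultimately show "x ^ n\<^sup>2 / z ^ n * (x ^ (k * (k - 1)) * qbinom x (2 * n) k * t ^ k)
        = x powi ((int k - int n)\<^sup>2) * z powi (int k - int n) * qbinom x (2 * n) k"
      by (simp add: t_def power_mult_distrib)
  qed simp
  finally show ?thesis .
qed

text \<open>The numerator is at most 1 and each factor below is at least \<open>qpoch_inf x\<close>.
  The bound is free of n and k, as a dominating constant must be.\<close>

lemma qbinom_bound: "\<bar>qbinom x n k\<bar> \<le> 1 / (qpoch_inf x)\<^sup>2"
proof (cases "k \<le> n")
  case True
  have "qpoch x n / (qpoch x k * qpoch x (n - k)) \<le> 1 / (qpoch_inf x * qpoch_inf x)"
    using qpoch_le_1 qpoch_inf_pos qpoch_inf_le qpoch_pos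
    by (intro frac_le mult_mono mult_pos_pos) (auto intro: less_imp_le)
  moreover have "0 \<le> qpoch x n / (qpoch x k * qpoch x (n - k))"
    using qpoch_pos by (simp add: less_imp_le)
  ultimately show ?thesis using True by (simp add: qbinom_def power2_eq_square)
qed (simp add: qbinom_def)

text \<open>Dominated convergence for the counting measure on the integers j = k - m. The case r = 0
  serves the triple product and even n, the case r = 1 serves odd n.\<close>

lemma tendsto_sum_qbinom:
  fixes c :: "int \<Rightarrow> real"
  assumes c: "Infinite_Set_Sum.abs_summable_on c UNIV"
  shows "(\<lambda>m. \<Sum>k\<le>2 * m + r. c (int k - int m) * qbinom x (2 * m + r) k)
    \<longlonglongrightarrow> infsetsum c UNIV / qpoch_inf x"
proof -
  \<comment> \<open>Padding each row by 0 puts all m on the same measure space.\<close>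
  define s where "s m j = (if - int m \<le> j \<and> j \<le> int (m + r)
    then c j * qbinom x (2 * m + r) (nat (j + int m)) else 0)" for m j
  have "(\<lambda>m. infsetsum (s m) UNIV) \<longlonglongrightarrow> infsetsum (\<lambda>j. c j / qpoch_inf x) UNIV"
    unfolding infsetsum_def
  proof (rule integral_dominated_convergence)
    show "integrable (count_space UNIV) (\<lambda>j. norm (c j) * (1 / (qpoch_inf x)\<^sup>2))"
      using c by (simp add: abs_summable_on_def)
    show "AE j in count_space UNIV. norm (s m j) \<le> norm (c j) * (1 / (qpoch_inf x)\<^sup>2)" for m
      using mult_left_mono[OF qbinom_bound] by (auto simp: s_def abs_mult)
    show "AE j in count_space UNIV. (\<lambda>m. s m j) \<longlonglongrightarrow> c j / qpoch_inf x"
    proof (rule AE_I2)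
      fix j :: int
      \<comment> \<open>The indices 2m + r, m + j and m + r - j are all at least m - |j|, so each of
        the three Pochhammer symbols tends to \<open>qpoch_inf x\<close>.\<close>
      have lim: "(\<lambda>m. qpoch x (f m)) \<longlonglongrightarrow> qpoch_inf x" if "\<And>m. m \<le> f m + nat \<bar>j\<bar>" for f :: "nat \<Rightarrow> nat"
      proof (rule filterlim_compose[OF qpoch_LIMSEQ])
        have "filterlim (\<lambda>m. m - nat \<bar>j\<bar>) sequentially sequentially"
          by (rule filterlim_minus_const_nat_at_top)
        then show "filterlim f sequentially sequentially"
          by (rule filterlim_at_top_mono) (use that in \<open>auto simp: le_diff_conv\<close>)
      qed
      have "(\<lambda>m. c j * (qpoch x (2 * m + r) / (qpoch x (nat (j + int m)) * qpoch x (nat (int (m + r) - j)))))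
          \<longlonglongrightarrow> c j * (qpoch_inf x / (qpoch_inf x * qpoch_inf x))"
        using qpoch_inf_pos by (intro tendsto_intros lim) auto
      then have "(\<lambda>m. c j * (qpoch x (2 * m + r) / (qpoch x (nat (j + int m)) * qpoch x (nat (int (m + r) - j)))))
          \<longlonglongrightarrow> c j / qpoch_inf x"
        using qpoch_inf_pos by simp
      moreover have "\<forall>\<^sub>F m in sequentially. c j * (qpoch x (2 * m + r) / (qpoch x (nat (j + int m)) * qpoch x (nat (int (m + r) - j)))) = s m j"
        using eventually_ge_at_top[of "nat \<bar>j\<bar>"]
      proof eventually_elim
        case (elim m)
        then have "- int m \<le> j" "j \<le> int (m + r)" "nat (j + int m) \<le> 2 * m + r" "2 * m + r - nat (j + int m) = nat (int (m + r) - j)" by auto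
        then show ?case using elim by (simp add: s_def qbinom_def)
      qed
      ultimately show "(\<lambda>m. s m j) \<longlonglongrightarrow> c j / qpoch_inf x"
        by (rule Lim_transform_eventually)
    qed
  qed simp_all
  moreover have "infsetsum (s m) UNIV = (\<Sum>k\<le>2 * m + r. c (int k - int m) * qbinom x (2 * m + r) k)" for m
  proof -
    have "infsetsum (s m) UNIV = infsetsum (s m) {- int m..int (m + r)}"
      by (rule infsetsum_cong_neutral) (auto simp: s_def)
    also have "\<dots> = (\<Sum>j\<in>{- int m..int (m + r)}. s m j)" by simp
    also have "\<dots> = (\<Sum>k\<le>2 * m + r. c (int k - int m) * qbinom x (2 * m + r) k)"
      by (rule sum.reindex_bij_witness[of _ "\<lambda>k. int k - int m" "\<lambda>j. nat (j + int m)"]) (auto simp: s_def)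
    finally show ?thesis .
  qed
  ultimately show ?thesis by (simp add: infsetsum_cdiv c)
qed

lemma jacobi_triple_product:
  assumes z: "z \<noteq> 0"
    and c: "Infinite_Set_Sum.abs_summable_on (\<lambda>j::int. x powi j\<^sup>2 * z powi j) UNIV"
  shows "(\<lambda>n. \<Prod>i<n. (1 + z * x ^ (2 * i + 1)) * (1 + x ^ (2 * i + 1) / z))
    \<longlonglongrightarrow> infsetsum (\<lambda>j. x powi j\<^sup>2 * z powi j) UNIV / qpoch_inf x"
  unfolding finite_jacobi_triple_product[OF z]
  using tendsto_sum_qbinom[OF c, of 0] unfolding add_0_right .

text \<open>Comparison with x^(|j|-1). The slack of 1 is there for the exponent 4j^2 - 4j, which
  vanishes at j = 1.\<close>

lemma abs_summable_power_int:
  assumes "\<And>j. \<bar>j\<bar> \<le> e j + 1"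
  shows "Infinite_Set_Sum.abs_summable_on (\<lambda>j::int. x powi e j) UNIV"
proof -
  have geom: "summable (\<lambda>n. x ^ n)" using x by (intro summable_geometric) auto
  have nat: "Infinite_Set_Sum.abs_summable_on (\<lambda>n. x ^ n) (UNIV :: nat set)"
    using geom x by (simp add: abs_summable_on_nat_iff' power_abs)
  have U: "(UNIV :: int set) = range int \<union> range (\<lambda>n. - int n)"
    by (auto simp: image_iff) (metis int_cases2)
  have "Infinite_Set_Sum.abs_summable_on (\<lambda>j::int. x ^ nat \<bar>j\<bar>) (range int)"
    using nat by (subst abs_summable_on_reindex_iff[symmetric]) (auto simp: inj_on_def)
  moreover have "Infinite_Set_Sum.abs_summable_on (\<lambda>j::int. x ^ nat \<bar>j\<bar>) (range (\<lambda>n. - int n))"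
    using nat by (subst abs_summable_on_reindex_iff[symmetric]) (auto simp: inj_on_def)
  ultimately have "Infinite_Set_Sum.abs_summable_on (\<lambda>j::int. x ^ nat \<bar>j\<bar>) UNIV"
    unfolding U by (rule abs_summable_on_union)
  then have "Infinite_Set_Sum.abs_summable_on (\<lambda>j::int. x ^ nat \<bar>j\<bar> * inverse x) UNIV"
    by (rule abs_summable_on_cmult_left)
  then show ?thesis
  proof (rule abs_summable_on_comparison_test)
    fix j :: int
    have "x powi e j \<le> x powi (\<bar>j\<bar> - 1)"
      using assms[of j] x by (intro power_int_decreasing) auto
    also have "\<dots> = x ^ nat \<bar>j\<bar> * inverse x"
      by (subst power_int_diff) (use x in \<open>auto simp: divide_inverse power_int_def\<close>)
    finally show "norm (x powi e j) \<le> norm (x ^ nat \<bar>j\<bar> * inverse x)"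
      using x by simp
  qed
qed

end

section \<open>Nondegenerate subspaces of a finite symplectic space\<close>

text \<open>Nondegeneracy is left to subsets of the type, so one instance covers the given space,
  its subspaces and all their complements.\<close>

locale alternating_space = vector_space scale
  for scale :: "'a::{field,finite} \<Rightarrow> 'v::ab_group_add \<Rightarrow> 'v" (infixr "\<star>" 75) +
  fixes B :: "'v \<Rightarrow> 'v \<Rightarrow> 'a"
  assumes add_left: "B (u + v) w = B u w + B v w"
    and add_right: "B w (u + v) = B w u + B w v"
    and scale_left: "B (c \<star> v) w = c * B v w"
    and scale_right: "B v (c \<star> w) = c * B v w"
    and alternating: "B v v = 0"
begin

lemma zero_left: "B 0 w = 0" and zero_right: "B w 0 = 0"
  using scale_left[of 0 0 w] scale_right[of w 0 0] by simp_all

lemma minus_left: "B (- v) w = - B v w" and minus_right: "B w (- v) = - B w v"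
  using add_left[of v "- v" w] add_right[of w v "- v"]
  by (simp_all add: zero_left zero_right eq_neg_iff_add_eq_0 add.commute)

lemma diff_left: "B (u - v) w = B u w - B v w" and diff_right: "B w (u - v) = B w u - B w v"
  using add_left[of u "- v" w] add_right[of w u "- v"] by (simp_all add: minus_left minus_right)

lemma swap: "B v u = - B u v"
proof -
  have "B u v + B v u = 0"
    using alternating[of "u + v"] unfolding add_left add_right by (simp add: alternating add.commute)
  then show ?thesis by (metis add.commute eq_neg_iff_add_eq_0)
qed

lemmas form_simps = add_left add_right scale_left scale_right alternating zero_left zero_right
  minus_left minus_right diff_left diff_right

text \<open>Finiteness is included because the ambient type may be infinite, as it is when the
  locale is applied, and \<open>card\<close> must be meaningful.\<close>

definition nondeg :: "'v set \<Rightarrow> bool" where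
  "nondeg W \<longleftrightarrow> subspace W \<and> finite W \<and> (\<forall>v\<in>W. (\<forall>w\<in>W. B v w = 0) \<longrightarrow> v = 0)"

definition hyp_pairs :: "'v set \<Rightarrow> ('v \<times> 'v) set" where
  "hyp_pairs W = {(e, f). e \<in> W \<and> f \<in> W \<and> B e f = 1}"

definition perp_pair :: "'v \<Rightarrow> 'v \<Rightarrow> 'v set \<Rightarrow> 'v set" where
  "perp_pair e f W = {w\<in>W. B e w = 0 \<and> B f w = 0}"

text \<open>The orthogonal projection off the plane of a hyperbolic pair: when B e f = 1, the
  coordinates of v in that plane are B v f along e and B e v along f.\<close>

definition perp_part :: "'v \<Rightarrow> 'v \<Rightarrow> 'v \<Rightarrow> 'v" where
  "perp_part e f v = v - B v f \<star> e - B e v \<star> f"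

lemma perp_part_decomp: "v = B v f \<star> e + B e v \<star> f + perp_part e f v"
  by (simp add: perp_part_def)

lemma perp_part_mem:
  assumes "subspace W" "(e, f) \<in> hyp_pairs W" "v \<in> W"
  shows "perp_part e f v \<in> perp_pair e f W"
proof -
  have ef: "B e f = 1" "B f e = - 1" "e \<in> W" "f \<in> W"
    using assms(2) swap[of f e] by (auto simp: hyp_pairs_def)
  have "B f v = - B v f" by (rule swap)
  then show ?thesis using assms ef
    by (simp add: perp_pair_def perp_part_def form_simps subspace_diff subspace_scale)
qed

lemma subspace_perp_pair: "subspace W \<Longrightarrow> subspace (perp_pair e f W)"
  unfolding perp_pair_def subspace_def by (auto simp: form_simps)

text \<open>Since B e f = 1, adding multiples of f moves each level set of \<open>B e\<close>
  bijectively onto the others.\<close>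

lemma card_level:
  assumes "subspace W" "(e, f) \<in> hyp_pairs W"
  shows "card W = CARD('a) * card {w\<in>W. B e w = c}"
proof -
  have ef: "B e f = 1" "e \<in> W" "f \<in> W" using assms(2) by (auto simp: hyp_pairs_def)
  have "bij_betw (\<lambda>(a, w). w + a \<star> f) (UNIV \<times> {w\<in>W. B e w = c}) W"
    by (rule bij_betw_byWitness[where f' = "\<lambda>w. (B e w - c, w - (B e w - c) \<star> f)"])
      (auto simp: ef form_simps subspace_add subspace_diff subspace_scale assms(1))
  from bij_betw_same_card[OF this] show ?thesis by (simp add: card_cartesian_product)
qed

text \<open>W is the direct sum of the plane of e, f and its complement; the plane contributes
  q^2.\<close>

lemma card_perp_pair:
  assumes "subspace W" "(e, f) \<in> hyp_pairs W"
  shows "card W = CARD('a)\<^sup>2 * card (perp_pair e f W)"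
proof -
  have ef: "B e f = 1" "B f e = - 1" "e \<in> W" "f \<in> W"
    using assms(2) swap[of f e] by (auto simp: hyp_pairs_def)
  have "bij_betw (\<lambda>((a, b), w). a \<star> e + b \<star> f + w) ((UNIV \<times> UNIV) \<times> perp_pair e f W) W"
  proof (rule bij_betw_byWitness[where f' = "\<lambda>v. ((B v f, B e v), perp_part e f v)"])
    show "\<forall>p\<in>(UNIV \<times> UNIV) \<times> perp_pair e f W.
      (\<lambda>v. ((B v f, B e v), perp_part e f v)) ((\<lambda>((a, b), w). a \<star> e + b \<star> f + w) p) = p"
    proof (clarsimp simp: perp_pair_def)
      fix a b w assume w: "B e w = 0" "B f w = 0"
      have "B w f = 0" using swap[of w f] w by simp
      then show "B (a \<star> e + b \<star> f + w) f = a \<and> B e (a \<star> e + b \<star> f + w) = b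
          \<and> perp_part e f (a \<star> e + b \<star> f + w) = w"
        using w ef by (simp add: perp_part_def form_simps)
    qed
    show "\<forall>v\<in>W. (\<lambda>((a, b), w). a \<star> e + b \<star> f + w) ((B v f, B e v), perp_part e f v) = v"
      using perp_part_decomp by simp
    show "(\<lambda>((a, b), w). a \<star> e + b \<star> f + w) ` ((UNIV \<times> UNIV) \<times> perp_pair e f W) \<subseteq> W"
      using ef assms(1) by (auto simp: perp_pair_def subspace_add subspace_scale)
    show "(\<lambda>v. ((B v f, B e v), perp_part e f v)) ` W \<subseteq> (UNIV \<times> UNIV) \<times> perp_pair e f W"
      using perp_part_mem[OF assms] by auto
  qed
  from bij_betw_same_card[OF this] show ?thesis
    by (simp add: card_cartesian_product power2_eq_square)
qed

text \<open>The plane of e, f is nondegenerate and splits off orthogonally, so a radical vector can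
  only lie in the complement. The forward direction shrinks spaces; the backward one is for
  rebuilding a subspace from its trace on the complement.\<close>

lemma nondeg_extend:
  assumes "nondeg W" "(e, f) \<in> hyp_pairs W" "subspace U" "U \<subseteq> W" "e \<in> U" "f \<in> U"
  shows "nondeg U \<longleftrightarrow> nondeg (perp_pair e f U)"
proof -
  have ef: "B e f = 1" "B f e = - 1" "(e, f) \<in> hyp_pairs U"
    using assms swap[of f e] by (auto simp: hyp_pairs_def)
  have fin: "finite U" "finite (perp_pair e f U)"
    using assms(1,4) finite_subset[of U W] by (auto simp: nondeg_def perp_pair_def)
  have "(\<forall>v\<in>U. (\<forall>w\<in>U. B v w = 0) \<longrightarrow> v = 0)
    \<longleftrightarrow> (\<forall>v\<in>perp_pair e f U. (\<forall>w\<in>perp_pair e f U. B v w = 0) \<longrightarrow> v = 0)" (is "?l \<longleftrightarrow> ?r")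
  proof
    assume l: ?l
    show ?r
    proof (intro ballI impI)
      fix v assume v: "v \<in> perp_pair e f U" "\<forall>w\<in>perp_pair e f U. B v w = 0"
      have ve: "B v e = 0" "B v f = 0" "v \<in> U"
        using v(1) swap[of v e] swap[of v f] by (auto simp: perp_pair_def)
      have "B v w = 0" if "w \<in> U" for w
        using v(2) perp_part_mem[OF assms(3) ef(3) that] ve
        by (subst perp_part_decomp[of w f e]) (simp add: form_simps)
      then show "v = 0" using l ve by blast
    qed
  next
    assume r: ?r
    show ?l
    proof (intro ballI impI)
      fix v assume v: "v \<in> U" "\<forall>w\<in>U. B v w = 0"
      have "B e v = 0" "B f v = 0" using v assms(5,6) swap[of e v] swap[of f v] by auto
      then have "v \<in> perp_pair e f U" using v by (simp add: perp_pair_def)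
      then show "v = 0" using r v(2) by (auto simp: perp_pair_def)
    qed
  qed
  then show ?thesis using fin assms(3) subspace_perp_pair by (auto simp: nondeg_def)
qed

lemma nondeg_perp_pair:
  assumes "nondeg W" "(e, f) \<in> hyp_pairs W"
  shows "nondeg (perp_pair e f W)"
  using nondeg_extend[OF assms] assms by (auto simp: nondeg_def hyp_pairs_def)

lemma exists_partner:
  assumes "nondeg W" "e \<in> W" "e \<noteq> 0"
  obtains f where "(e, f) \<in> hyp_pairs W"
proof -
  obtain w where w: "w \<in> W" "B e w \<noteq> 0" using assms by (auto simp: nondeg_def)
  have "(e, inverse (B e w) \<star> w) \<in> hyp_pairs W"
    using w assms by (auto simp: hyp_pairs_def form_simps nondeg_def subspace_scale)
  then show ?thesis using that by blast
qed

text \<open>Each nonzero e has a partner, and then by \<open>card_level\<close> at level 1 exactly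
  \<open>card W\<close> / q of them.\<close>

lemma card_hyp_pairs:
  assumes "nondeg W"
  shows "CARD('a) * card (hyp_pairs W) = (card W - 1) * card W"
proof -
  have W: "subspace W" "finite W" "0 \<in> W" using assms by (auto simp: nondeg_def subspace_0)
  have eq: "hyp_pairs W = Sigma (W - {0}) (\<lambda>e. {f\<in>W. B e f = 1})"
    by (auto simp: hyp_pairs_def form_simps)
  have "CARD('a) * card {f\<in>W. B e f = 1} = card W" if "e \<in> W - {0}" for e
    using exists_partner[OF assms, of e] card_level[OF W(1)] that by (metis DiffE insertI1)
  then have "CARD('a) * card (hyp_pairs W) = (\<Sum>e\<in>W - {0}. card W)"
    using W unfolding eq by (simp add: card_SigmaI sum_distrib_left)
  then show ?thesis using W by (simp add: card_Diff_singleton)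
qed

text \<open>Splitting off hyperbolic planes takes the place of a symplectic basis. The complement is
  strictly smaller because it misses e, as B f e = -1.\<close>

lemma nondeg_induct [consumes 1, case_names zero step]:
  assumes "nondeg W"
    and "P {0}"
    and "\<And>W e f. nondeg W \<Longrightarrow> (e, f) \<in> hyp_pairs W \<Longrightarrow> P (perp_pair e f W) \<Longrightarrow> P W"
  shows "P W"
  using assms(1)
proof (induction "card W" arbitrary: W rule: less_induct)
  case less
  have W: "subspace W" "finite W" "0 \<in> W" using less.prems by (auto simp: nondeg_def subspace_0)
  show ?case
  proof (cases "W = {0}")
    case False
    then obtain e where "e \<in> W" "e \<noteq> 0" using W by blast
    then obtain f where ef: "(e, f) \<in> hyp_pairs W" using exists_partner less.prems by blast
    have "e \<in> W - perp_pair e f W" using ef swap[of f e] by (auto simp: hyp_pairs_def perp_pair_def)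
    then have "perp_pair e f W \<subset> W" by (auto simp: perp_pair_def)
    then have "card (perp_pair e f W) < card W" using W psubset_card_mono by blast
    then show ?thesis using less.hyps nondeg_perp_pair less.prems ef assms(3) by blast
  qed (use assms(2) in simp)
qed

lemma card_nondeg:
  assumes "nondeg W"
  obtains m where "card W = CARD('a) ^ (2 * m)"
proof -
  from assms have "\<exists>m. card W = CARD('a) ^ (2 * m)"
  proof (induction rule: nondeg_induct)
    case zero
    show ?case by (rule exI[of _ 0]) simp
  next
    case (step W e f)
    then obtain m where "card (perp_pair e f W) = CARD('a) ^ (2 * m)" by blast
    then have "card W = CARD('a) ^ (2 * Suc m)"
      using card_perp_pair[of W e f] step(1,2) by (simp add: nondeg_def power2_eq_square)
    then show ?case by blast
  qed
  then show ?thesis using that by blast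
qed

text \<open>To the plane coordinates of v is added the projection that the induction hypothesis
  supplies for \<open>perp_part e f v\<close>.\<close>

lemma orthogonal_decomp:
  assumes "nondeg U"
  shows "\<exists>u\<in>U. \<forall>x\<in>U. B x (v - u) = 0"
  using assms
proof (induction arbitrary: v rule: nondeg_induct)
  case zero
  show ?case by (simp add: form_simps)
next
  case (step U e f)
  have U: "subspace U" "e \<in> U" "f \<in> U" "B e f = 1" "B f e = - 1"
    using step swap[of f e] by (auto simp: nondeg_def hyp_pairs_def)
  obtain u where u: "u \<in> perp_pair e f U" "\<forall>x\<in>perp_pair e f U. B x (perp_part e f v - u) = 0"
    using step.IH by blast
  let ?u = "B v f \<star> e + B e v \<star> f + u"
  have eq: "v - ?u = perp_part e f v - u" by (simp add: perp_part_def algebra_simps)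
  have e0: "B e (v - ?u) = 0" "B f (v - ?u) = 0"
    using u(1) U swap[of f v] by (auto simp: perp_pair_def form_simps)
  have "B x (v - ?u) = 0" if "x \<in> U" for x
    using u(2) perp_part_mem[OF U(1) step(2) that] e0
    by (subst perp_part_decomp[of x f e]) (simp add: eq add_left scale_left)
  moreover have "?u \<in> U" using U u(1) by (auto simp: perp_pair_def intro!: subspace_add subspace_scale)
  ultimately show ?case by blast
qed

section \<open>Counting nondegenerate subspaces by their hyperbolic pairs\<close>

definition nondeg_subspaces :: "nat \<Rightarrow> 'v set \<Rightarrow> 'v set set" where
  "nondeg_subspaces k W = {U. nondeg U \<and> U \<subseteq> W \<and> card U = CARD('a) ^ (2 * k)}"

text \<open>Cutting with the complement and adding the plane back are mutually inverse. The second
  map is written as a preimage under the linear map \<open>perp_part e f\<close>, which makes it a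
  subspace at once.\<close>

lemma card_subspaces_through_pair:
  assumes W: "nondeg W" and ef: "(e, f) \<in> hyp_pairs W"
  shows "card {U\<in>nondeg_subspaces (Suc k) W. e \<in> U \<and> f \<in> U}
       = card (nondeg_subspaces k (perp_pair e f W))"
proof (rule bij_betw_same_card[of "perp_pair e f"],
    rule bij_betw_byWitness[where f' = "\<lambda>U. {v\<in>W. perp_part e f v \<in> U}"])
  have sW: "subspace W" using W by (simp add: nondeg_def)
  have e: "e \<in> W" "f \<in> W" "B e f = 1" "B f e = - 1"
    using ef swap[of f e] by (auto simp: hyp_pairs_def)
  have pp_ef: "perp_part e f e = 0" "perp_part e f f = 0"
    using e by (simp_all add: perp_part_def form_simps)
  have pp: "perp_part e f w = w" if "B e w = 0" "B f w = 0" for w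
    using that swap[of w f] by (simp add: perp_part_def)
  have inv_U: "perp_pair e f {v\<in>W. perp_part e f v \<in> U} = U" if "U \<subseteq> perp_pair e f W" for U
    using that pp unfolding perp_pair_def by (auto simp: subset_iff)
  have sub: "subspace {v\<in>W. perp_part e f v \<in> U}" if U: "subspace U" for U
  proof -
    have a: "perp_part e f (u + v) = perp_part e f u + perp_part e f v" for u v
      by (simp add: perp_part_def form_simps algebra_simps)
    have s: "perp_part e f (c \<star> v) = c \<star> perp_part e f v" for c v
      by (simp add: perp_part_def form_simps algebra_simps)
    have z: "perp_part e f 0 = 0" by (simp add: perp_part_def form_simps)
    show ?thesis
      using U sW by (auto simp: subspace_def a s z)
  qed
  have q: "CARD('a) > 0" by simp
  show "\<forall>U\<in>{U\<in>nondeg_subspaces (Suc k) W. e \<in> U \<and> f \<in> U}.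
      {v\<in>W. perp_part e f v \<in> perp_pair e f U} = U"
  proof safe
    fix U v assume U: "U \<in> nondeg_subspaces (Suc k) W" "e \<in> U" "f \<in> U"
    have sU: "subspace U" "U \<subseteq> W" using U by (auto simp: nondeg_subspaces_def nondeg_def)
    then have efU: "(e, f) \<in> hyp_pairs U" using U e by (simp add: hyp_pairs_def)
    { assume "v \<in> U"
      then show "v \<in> W" "perp_part e f v \<in> perp_pair e f U"
        using sU perp_part_mem[OF sU(1) efU] by auto }
    { assume "perp_part e f v \<in> perp_pair e f U"
      then have "B v f \<star> e + B e v \<star> f + perp_part e f v \<in> U"
        using sU U by (auto simp: perp_pair_def intro!: subspace_add subspace_scale)
      then show "v \<in> U" by (simp add: perp_part_decomp[of v f e, symmetric]) }
  qed
  show "\<forall>U\<in>nondeg_subspaces k (perp_pair e f W).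
      perp_pair e f {v\<in>W. perp_part e f v \<in> U} = U"
    using inv_U by (simp add: nondeg_subspaces_def)
  show "perp_pair e f ` {U\<in>nondeg_subspaces (Suc k) W. e \<in> U \<and> f \<in> U}
      \<subseteq> nondeg_subspaces k (perp_pair e f W)"
  proof safe
    fix U assume U: "U \<in> nondeg_subspaces (Suc k) W" "e \<in> U" "f \<in> U"
    have sU: "subspace U" "U \<subseteq> W" "nondeg U" "card U = CARD('a) ^ (2 * Suc k)"
      using U by (auto simp: nondeg_subspaces_def nondeg_def)
    then have efU: "(e, f) \<in> hyp_pairs U" using U e by (simp add: hyp_pairs_def)
    have "CARD('a)\<^sup>2 * card (perp_pair e f U) = CARD('a)\<^sup>2 * CARD('a) ^ (2 * k)"
      using card_perp_pair[OF sU(1) efU] sU(4) by (simp add: power2_eq_square)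
    then have "card (perp_pair e f U) = CARD('a) ^ (2 * k)" using q by simp
    then show "perp_pair e f U \<in> nondeg_subspaces k (perp_pair e f W)"
      using nondeg_perp_pair[OF sU(3) efU] sU(2) by (auto simp: nondeg_subspaces_def perp_pair_def)
  qed
  show "(\<lambda>U. {v\<in>W. perp_part e f v \<in> U}) ` nondeg_subspaces k (perp_pair e f W)
      \<subseteq> {U\<in>nondeg_subspaces (Suc k) W. e \<in> U \<and> f \<in> U}"
  proof (rule image_subsetI)
    fix U assume U: "U \<in> nondeg_subspaces k (perp_pair e f W)"
    let ?V = "{v\<in>W. perp_part e f v \<in> U}"
    have sU: "subspace U" "U \<subseteq> perp_pair e f W" "nondeg U" "card U = CARD('a) ^ (2 * k)"
      using U by (auto simp: nondeg_subspaces_def nondeg_def)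
    have mem: "e \<in> ?V" "f \<in> ?V" using e pp_ef subspace_0[OF sU(1)] by auto
    have efV: "(e, f) \<in> hyp_pairs ?V" using mem e by (simp add: hyp_pairs_def)
    have "nondeg ?V"
      using nondeg_extend[OF W ef sub[OF sU(1)] _ mem] inv_U[OF sU(2)] sU(3) by simp
    moreover have "card ?V = CARD('a) ^ (2 * Suc k)"
      using card_perp_pair[OF sub[OF sU(1)] efV] inv_U[OF sU(2)] sU(4) by (simp add: power2_eq_square)
    ultimately show "?V \<in> {U\<in>nondeg_subspaces (Suc k) W. e \<in> U \<and> f \<in> U}"
      using mem unfolding nondeg_subspaces_def by blast
  qed
qed

lemma finite_nondeg_subspaces: "finite W \<Longrightarrow> finite (nondeg_subspaces k W)"
  by (rule finite_subset[of _ "Pow W"]) (auto simp: nondeg_subspaces_def)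

text \<open>The factor 1 - x^(2m), with x = 1/q, is isolated so that successive ratios of these
  counts build up quotients of \<open>qpoch\<close>.\<close>

lemma card_hyp_pairs_real:
  assumes "nondeg W" "card W = CARD('a) ^ (2 * m)"
  shows "real CARD('a) * real (card (hyp_pairs W)) = real CARD('a) ^ (4 * m) * (1 - (1 / real CARD('a)) ^ (2 * m))"
proof -
  have q: "CARD('a) ^ (2 * m) \<ge> 1" by simp
  have "real CARD('a) * real (card (hyp_pairs W)) = real ((CARD('a) ^ (2 * m) - 1) * CARD('a) ^ (2 * m))"
    by (metis card_hyp_pairs[OF assms(1)] assms(2) of_nat_mult)
  also have "\<dots> = (real CARD('a) ^ (2 * m) - 1) * real CARD('a) ^ (2 * m)"
    using q by (simp add: of_nat_diff)
  also have "\<dots> = real CARD('a) ^ (4 * m) * (1 - (1 / real CARD('a)) ^ (2 * m))"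
    by (simp add: field_simps flip: power_add)
  finally show ?thesis .
qed

text \<open>The pairs \<open>(p, U)\<close> with \<open>p\<close> a hyperbolic pair of \<open>U\<close> are counted in two ways.\<close>

lemma card_nondeg_subspaces_Suc:
  assumes W: "nondeg W" and c: "card W = CARD('a) ^ (2 * Suc m)"
    and I: "\<And>e f. (e, f) \<in> hyp_pairs W \<Longrightarrow> real (card (nondeg_subspaces k (perp_pair e f W))) = N"
  shows "real (card (nondeg_subspaces (Suc k) W)) * (real CARD('a) ^ (4 * Suc k) * (1 - (1 / real CARD('a)) ^ (2 * Suc k)))
     = real CARD('a) ^ (4 * Suc m) * (1 - (1 / real CARD('a)) ^ (2 * Suc m)) * N"
proof -
  let ?q = "real CARD('a)"
  let ?S = "nondeg_subspaces (Suc k) W"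
  have fin: "finite ?S" "finite (hyp_pairs W)"
    using W finite_nondeg_subspaces finite_subset[of "hyp_pairs W" "W \<times> W"]
    by (auto simp: nondeg_def hyp_pairs_def)
  have "real (card ?S) * (?q ^ (4 * Suc k) * (1 - (1 / ?q) ^ (2 * Suc k)))
      = (\<Sum>U\<in>?S. ?q * real (card (hyp_pairs U)))"
    using card_hyp_pairs_real[of _ "Suc k"] by (simp add: nondeg_subspaces_def)
  also have "\<dots> = ?q * (\<Sum>U\<in>?S. \<Sum>p\<in>{p\<in>hyp_pairs W. fst p \<in> U \<and> snd p \<in> U}. 1)"
    unfolding sum_distrib_left
  proof (rule sum.cong)
    fix U assume "U \<in> ?S"
    then have "hyp_pairs U = {p\<in>hyp_pairs W. fst p \<in> U \<and> snd p \<in> U}"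
      by (auto simp: hyp_pairs_def nondeg_subspaces_def)
    then show "?q * real (card (hyp_pairs U)) = (\<Sum>p\<in>{p\<in>hyp_pairs W. fst p \<in> U \<and> snd p \<in> U}. ?q * 1)"
      by simp
  qed simp
  also have "\<dots> = ?q * (\<Sum>p\<in>hyp_pairs W. \<Sum>U\<in>{U\<in>?S. fst p \<in> U \<and> snd p \<in> U}. 1)"
    by (subst sum.swap_restrict[OF fin]) simp
  also have "\<dots> = ?q * (\<Sum>p\<in>hyp_pairs W. N)"
  proof -
    have "real (card {U\<in>?S. fst p \<in> U \<and> snd p \<in> U}) = N" if "p \<in> hyp_pairs W" for p
      using card_subspaces_through_pair[OF W, of "fst p" "snd p" k] I[of "fst p" "snd p"] that by simp
    then show ?thesis by simp
  qed
  also have "\<dots> = ?q ^ (4 * Suc m) * (1 - (1 / ?q) ^ (2 * Suc m)) * N"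
    using card_hyp_pairs_real[OF W c] by (simp add: mult.assoc)
  finally show ?thesis .
qed

lemma card_field_gt_1: "CARD('a) > 1"
proof -
  have "card {0::'a, 1} \<le> CARD('a)" by (rule card_mono) auto
  then show ?thesis by simp
qed

text \<open>Let N(k, m) be the count. The double count gives N(k+1, m+1) = q^(4(m-k)) (1 - x^(2m+2))
  / (1 - x^(2k+2)) N(k, m). As m - k is the same at every step, k steps from N(0, m-k) = 1 yield the
  exponent 4k(m-k).\<close>

lemma card_nondeg_subspaces:
  assumes "nondeg W" "card W = CARD('a) ^ (2 * m)" "k \<le> m"
  shows "real (card (nondeg_subspaces k W)) = real CARD('a) ^ (4 * k * (m - k))
     * qpoch (1 / real CARD('a)) m / (qpoch (1 / real CARD('a)) k * qpoch (1 / real CARD('a)) (m - k))"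
proof -
  let ?q = "real CARD('a)"
  have q: "?q > 1" using card_field_gt_1 by simp
  have factor: "1 - (1 / ?q) ^ (2 * Suc n) \<noteq> 0" for n
    using power_strict_mono[of "1/?q" 1 "2 * Suc n"] q by simp
  have nz: "qpoch (1 / ?q) n \<noteq> 0" for n
    using factor by (auto simp: qpoch_def)
  show ?thesis using assms
  proof (induction k arbitrary: m W)
    case 0
    have "U = {0}" if "nondeg U" "card U = 1" for U
      using that subspace_0 by (auto simp: nondeg_def card_1_singleton_iff)
    moreover have "nondeg {0}" by (auto simp: nondeg_def subspace_def)
    moreover have "0 \<in> W" using 0 subspace_0 by (auto simp: nondeg_def)
    ultimately have "U \<in> nondeg_subspaces 0 W \<longleftrightarrow> U = {0}" for U
      unfolding nondeg_subspaces_def mem_Collect_eq mult_0_right power_0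
      by (metis card.empty card_insert_disjoint empty_iff empty_subsetI finite.emptyI insert_subset One_nat_def)
    then have "nondeg_subspaces 0 W = {{0}}" by blast
    then show ?case using nz by (simp add: qpoch_def[of _ 0])
  next
    case (Suc k)
    then obtain m' where m: "m = Suc m'" "k \<le> m'" by (cases m) auto
    let ?P = "qpoch (1 / ?q)"
    let ?N = "?q ^ (4 * k * (m' - k)) * ?P m' / (?P k * ?P (m' - k))"
    have W: "subspace W" using Suc.prems by (simp add: nondeg_def)
    have "real (card (nondeg_subspaces k (perp_pair e f W))) = ?N" if ef: "(e, f) \<in> hyp_pairs W" for e f
    proof (rule Suc.IH)
      show "nondeg (perp_pair e f W)" by (rule nondeg_perp_pair[OF Suc.prems(1) ef])
      show "card (perp_pair e f W) = CARD('a) ^ (2 * m')"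
        using card_perp_pair[OF W ef] Suc.prems(2) m by (simp add: power2_eq_square)
    qed (fact m)
    from card_nondeg_subspaces_Suc[OF Suc.prems(1) Suc.prems(2)[unfolded m] this]
    have eq: "real (card (nondeg_subspaces (Suc k) W)) * (?q ^ (4 * Suc k) * (1 - (1 / ?q) ^ (2 * Suc k)))
        = ?q ^ (4 * Suc m') * (1 - (1 / ?q) ^ (2 * Suc m')) * ?N" .
    have PS: "?P (Suc n) = ?P n * (1 - (1 / ?q) ^ (2 * Suc n))" for n
      by (simp add: qpoch_def)
    have "4 * Suc m' + 4 * k * (m' - k) = 4 * Suc k * (m' - k) + 4 * Suc k"
    proof -
      obtain d where "m' = k + d" using m le_Suc_ex by blast
      then show ?thesis by (simp add: algebra_simps)
    qed
    then have pw: "?q ^ (4 * Suc m') * ?q ^ (4 * k * (m' - k)) = ?q ^ (4 * Suc k * (m' - k)) * ?q ^ (4 * Suc k)"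
      by (metis power_add)
    have "?q ^ (4 * Suc k) * (1 - (1 / ?q) ^ (2 * Suc k)) \<noteq> 0"
      using factor[of k] q by (simp del: power_Suc)
    moreover have "(?q ^ (4 * Suc k * (m' - k)) * ?P (Suc m') / (?P (Suc k) * ?P (m' - k)))
        * (?q ^ (4 * Suc k) * (1 - (1 / ?q) ^ (2 * Suc k)))
      = ?q ^ (4 * Suc m') * (1 - (1 / ?q) ^ (2 * Suc m')) * ?N"
    proof -
      have gen: "(A * (p * b) / (r * c * s)) * (D * c) = E * b * (F * p / (r * s))"
        if "E * F = A * D" "c \<noteq> 0" for A D E F b c p r s :: real
      proof -
        have "(A * (p * b) / (r * c * s)) * (D * c) = (A * D) * b * p / (r * s)"
          using that(2) by simp
        also have "\<dots> = E * b * (F * p / (r * s))" unfolding that(1)[symmetric] by simp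
        finally show ?thesis .
      qed
      show ?thesis unfolding PS by (rule gen[OF pw factor])
    qed
    ultimately have "real (card (nondeg_subspaces (Suc k) W))
        = ?q ^ (4 * Suc k * (m' - k)) * ?P (Suc m') / (?P (Suc k) * ?P (m' - k))"
      using eq by (metis mult_right_cancel)
    then show ?case using m by simp
  qed
qed

lemma card_all_nondeg_subspaces:
  assumes "nondeg W" "card W = CARD('a) ^ (2 * m)"
  shows "real (card {U. nondeg U \<and> U \<subseteq> W}) = (\<Sum>k\<le>m. real CARD('a) ^ (4 * k * (m - k))
     * qpoch (1 / real CARD('a)) m / (qpoch (1 / real CARD('a)) k * qpoch (1 / real CARD('a)) (m - k)))"
proof -
  have finW: "finite W" using assms(1) by (simp add: nondeg_def)
  have eq: "{U. nondeg U \<and> U \<subseteq> W} = (\<Union>k\<in>{..m}. nondeg_subspaces k W)"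
  proof (intro equalityI subsetI)
    fix U assume "U \<in> {U. nondeg U \<and> U \<subseteq> W}"
    then have U: "nondeg U" "U \<subseteq> W" by auto
    obtain k where k: "card U = CARD('a) ^ (2 * k)" using card_nondeg[OF U(1)] .
    have "CARD('a) ^ (2 * k) \<le> CARD('a) ^ (2 * m)" using card_mono[OF finW U(2)] k assms(2) by simp
    then have "k \<le> m" using power_le_imp_le_exp[OF card_field_gt_1] by fastforce
    then show "U \<in> (\<Union>k\<in>{..m}. nondeg_subspaces k W)" using U k by (auto simp: nondeg_subspaces_def)
  qed (auto simp: nondeg_subspaces_def)
  have "card {U. nondeg U \<and> U \<subseteq> W} = (\<Sum>k\<le>m. card (nondeg_subspaces k W))"
    unfolding eq
  proof (rule card_UN_disjoint)
    show "\<forall>i\<in>{..m}. \<forall>j\<in>{..m}. i \<noteq> j \<longrightarrow> nondeg_subspaces i W \<inter> nondeg_subspaces j W = {}"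
      using card_field_gt_1 by (auto simp: nondeg_subspaces_def power_inject_exp)
  qed (use finW finite_nondeg_subspaces in auto)
  then show ?thesis using card_nondeg_subspaces[OF assms] by simp
qed

section \<open>Involutions in the symplectic group\<close>

text \<open>The value 0 outside W makes maps that agree on W equal, so the cardinality counts maps
  of W. Bijectivity is implied by \<sigma> being its own inverse on W.\<close>

definition involutions :: "'v set \<Rightarrow> ('v \<Rightarrow> 'v) set" where
  "involutions W = {\<sigma>. (\<forall>v\<in>W. \<sigma> v \<in> W \<and> \<sigma> (\<sigma> v) = v) \<and> (\<forall>v. v \<notin> W \<longrightarrow> \<sigma> v = 0) \<and>
     (\<forall>u\<in>W. \<forall>v\<in>W. \<sigma> (u + v) = \<sigma> u + \<sigma> v \<and> B (\<sigma> u) (\<sigma> v) = B u v) \<and>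
     (\<forall>c. \<forall>v\<in>W. \<sigma> (c \<star> v) = c \<star> \<sigma> v)}"

lemma double_eq_0:
  assumes "(2::'a) \<noteq> 0" "v + v = (0::'v)"
  shows "v = 0"
proof -
  have "2 \<star> v = v + v" by (metis one_add_one scale_left_distrib scale_one)
  then show ?thesis using assms by (metis scale_eq_0_iff)
qed

text \<open>Twice any w is (w - \<sigma> w) + (w + \<sigma> w), a vector of M plus a fixed vector,
  and fixed vectors are orthogonal to M. Hence a radical vector of M is orthogonal to all of W.
  Conversely, if y is orthogonal to M then y - \<sigma> y lies in M and is orthogonal to it, hence
  vanishes.\<close>

lemma involution_facts:
  assumes W: "nondeg W" and two: "(2::'a) \<noteq> 0" and s: "\<sigma> \<in> involutions W"
  defines "M \<equiv> {v\<in>W. \<sigma> v = - v}"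
  shows "nondeg M" and "\<And>y. y \<in> W \<Longrightarrow> \<forall>x\<in>M. B x y = 0 \<Longrightarrow> \<sigma> y = y"
proof -
  have sW: "subspace W" "finite W" using W by (auto simp: nondeg_def)
  have mem: "\<sigma> v \<in> W" "\<sigma> (\<sigma> v) = v" if "v \<in> W" for v
    using s that by (auto simp: involutions_def)
  have add: "\<sigma> (u + v) = \<sigma> u + \<sigma> v" "B (\<sigma> u) (\<sigma> v) = B u v" if "u \<in> W" "v \<in> W" for u v
    using s that by (auto simp: involutions_def)
  have scal: "\<sigma> (c \<star> v) = c \<star> \<sigma> v" if "v \<in> W" for c v
    using s that by (auto simp: involutions_def)
  have neg: "\<sigma> (- v) = - \<sigma> v" if "v \<in> W" for v
    using scal[OF that, of "- 1"] by simp
  have diff: "\<sigma> (u - v) = \<sigma> u - \<sigma> v" if "u \<in> W" "v \<in> W" for u v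
    using add(1)[of u "- v"] neg that subspace_neg[OF sW(1)] by simp
  have orth: "B x y = 0" if "x \<in> M" "y \<in> W" "\<sigma> y = y" for x y
  proof -
    have "B x y = - B x y" using add(2)[of x y] that by (simp add: M_def minus_left)
    then have "2 * B x y = 0" by (metis eq_neg_iff_add_eq_0 mult_2)
    then show ?thesis using two by simp
  qed
  have minus_part: "y - \<sigma> y \<in> M" if "y \<in> W" for y
    using that mem diff subspace_diff[OF sW(1)] by (simp add: M_def)
  have M: "subspace M" "finite M" "M \<subseteq> W"
    using sW subspace_0[OF sW(1)] scal[of 0 0] by (auto simp: M_def subspace_def add scal)
  have "v = 0" if v: "v \<in> M" and o: "\<forall>w\<in>M. B v w = 0" for v
  proof -
    have "B v w = 0" if w: "w \<in> W" for w
    proof -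
      have 1: "B v (w - \<sigma> w) = 0" using minus_part o w by blast
      have "\<sigma> (w + \<sigma> w) = w + \<sigma> w" using w mem add by (simp add: add.commute)
      then have 2: "B v (w + \<sigma> w) = 0"
        using orth v w mem subspace_add[OF sW(1)] by blast
      have "2 * B v w = 0" using 1 2 by (simp add: form_simps)
      then show ?thesis using two by simp
    qed
    then show ?thesis using W v M(3) by (auto simp: nondeg_def)
  qed
  then show nM: "nondeg M" using M by (auto simp: nondeg_def)
  fix y assume y: "y \<in> W" "\<forall>x\<in>M. B x y = 0"
  have "B (y - \<sigma> y) x = 0" if x: "x \<in> M" for x
  proof -
    have "B x (\<sigma> y) = - B x y"
      using add(2)[of x "\<sigma> y"] x y mem by (simp add: M_def minus_left)
    then have "B x (y - \<sigma> y) = 0" using x y by (simp add: diff_right)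
    then show ?thesis using swap[of "y - \<sigma> y" x] by simp
  qed
  then have "y - \<sigma> y = 0" using nM minus_part[OF y(1)] by (auto simp: nondeg_def)
  then show "\<sigma> y = y" by simp
qed

text \<open>The involution is v - 2 p v, where p is the orthogonal projection onto U.\<close>

lemma involution_with_minus_space:
  assumes W: "nondeg W" and two: "(2::'a) \<noteq> 0" and U: "nondeg U" "U \<subseteq> W"
  shows "\<exists>\<sigma>\<in>involutions W. {v\<in>W. \<sigma> v = - v} = U"
proof -
  have sW: "subspace W" and sU: "subspace U" using W U by (auto simp: nondeg_def)
  define p where "p v = (SOME u. u \<in> U \<and> (\<forall>x\<in>U. B x (v - u) = 0))" for v
  have p: "p v \<in> U \<and> (\<forall>x\<in>U. B x (v - p v) = 0)" for v
    unfolding p_def by (rule someI_ex) (use orthogonal_decomp[OF U(1)] in blast)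
  \<comment> \<open>The projection is picked by choice; nondegeneracy of U makes it unique, and
    linearity of p follows from uniqueness.\<close>
  have p_unique: "p v = u" if u: "u \<in> U" "\<forall>x\<in>U. B x (v - u) = 0" for u v
  proof -
    have "B (u - p v) x = 0" if "x \<in> U" for x
    proof -
      have "B x (u - p v) = B x (v - p v) - B x (v - u)" by (simp add: form_simps)
      then show ?thesis using p[of v] u(2) that swap[of "u - p v" x] by simp
    qed
    moreover have "u - p v \<in> U" using p[of v] u(1) subspace_diff[OF sU] by blast
    ultimately have "u - p v = 0" using U(1) unfolding nondeg_def by blast
    then show ?thesis by simp
  qed
  have p_add: "p (u + v) = p u + p v" for u v
  proof (rule p_unique)
    show "\<forall>x\<in>U. B x (u + v - (p u + p v)) = 0"
    proof
      fix x assume "x \<in> U"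
      then have "B x (u - p u) + B x (v - p v) = 0" using p by simp
      then show "B x (u + v - (p u + p v)) = 0" by (simp add: form_simps algebra_simps)
    qed
  qed (use p subspace_add[OF sU] in blast)
  have p_scale: "p (c \<star> v) = c \<star> p v" for c v
  proof (rule p_unique)
    show "\<forall>x\<in>U. B x (c \<star> v - c \<star> p v) = 0"
    proof
      fix x assume "x \<in> U"
      then have "c * B x (v - p v) = 0" using p by simp
      then show "B x (c \<star> v - c \<star> p v) = 0" by (simp add: form_simps algebra_simps)
    qed
  qed (use p subspace_scale[OF sU] in blast)
  have p_id: "p u = u" if "u \<in> U" for u
    using that by (intro p_unique) (auto simp: zero_right)
  have p_neg: "p (- v) = - p v" for v using p_scale[of "- 1" v] by simp
  have p_diff: "p (u - v) = p u - p v" for u v using p_add[of u "- v"] p_neg by simp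
  \<comment> \<open>p is self-adjoint and idempotent, so in the expansion of B (\<sigma> u)
    (\<sigma> v) the two cross terms -2 B (p u) (p v) cancel 4 B (p u) (p v).\<close>
  have B_p: "B (p u) v = B (p u) (p v)" "B u (p v) = B (p u) (p v)" for u v
  proof -
    show 1: "B (p u) v = B (p u) (p v)" for u v using p[of v] p[of u] by (simp add: diff_right)
    show "B u (p v) = B (p u) (p v)"
      using 1[of v u] swap[of u "p v"] swap[of "p u" "p v"] by simp
  qed
  define \<sigma> where "\<sigma> v = (if v \<in> W then v - p v - p v else 0)" for v
  have pW: "p v \<in> W" for v using p U(2) by blast
  have mem: "v - p v - p v \<in> W" if "v \<in> W" for v
    using that pW subspace_diff[OF sW] by blast
  have "\<sigma> \<in> involutions W"
    unfolding involutions_def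
  proof (intro CollectI conjI ballI allI impI)
    fix u v assume uv: "u \<in> W" "v \<in> W"
    show "\<sigma> (u + v) = \<sigma> u + \<sigma> v"
      using uv subspace_add[OF sW] by (simp add: \<sigma>_def p_add)
    show "B (\<sigma> u) (\<sigma> v) = B u v"
      using uv B_p by (simp add: \<sigma>_def form_simps)
  next
    fix v assume v: "v \<in> W"
    show "\<sigma> v \<in> W" using v mem by (simp add: \<sigma>_def)
    have "p (p v) = p v" using p p_id by blast
    then show "\<sigma> (\<sigma> v) = v" using v mem by (simp add: \<sigma>_def p_diff)
  next
    fix c v assume "v \<in> W"
    then show "\<sigma> (c \<star> v) = c \<star> \<sigma> v"
      using subspace_scale[OF sW] by (simp add: \<sigma>_def p_scale scale_right_diff_distrib)
  qed (simp add: \<sigma>_def)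
  moreover have "{v\<in>W. \<sigma> v = - v} = U"
  proof (intro equalityI subsetI)
    fix v assume v: "v \<in> {v\<in>W. \<sigma> v = - v}"
    then have "v - p v - p v = - v" by (auto simp: \<sigma>_def)
    then have "(v - p v) + (v - p v) = 0" by (simp add: algebra_simps)
    then have "v - p v = 0" by (rule double_eq_0[OF two])
    then show "v \<in> U" using p[of v] by simp
  next
    fix v assume "v \<in> U"
    then show "v \<in> {v\<in>W. \<sigma> v = - v}" using U(2) p_id by (auto simp: \<sigma>_def)
  qed
  ultimately show ?thesis by blast
qed

text \<open>Write y = u + (y - u) with u in the common (-1)-eigenspace and y - u orthogonal to it.
  Both maps negate u and fix y - u.\<close>

lemma involution_eqI:
  assumes W: "nondeg W" and two: "(2::'a) \<noteq> 0"
    and s: "\<sigma> \<in> involutions W" and t: "\<tau> \<in> involutions W"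
    and eq: "{v\<in>W. \<sigma> v = - v} = {v\<in>W. \<tau> v = - v}"
  shows "\<sigma> = \<tau>"
proof
  fix y
  show "\<sigma> y = \<tau> y"
  proof (cases "y \<in> W")
    case True
    note fs = involution_facts[OF W two s] and ft = involution_facts[OF W two t]
    obtain u where u: "u \<in> {v\<in>W. \<sigma> v = - v}" "\<forall>x\<in>{v\<in>W. \<sigma> v = - v}. B x (y - u) = 0"
      using orthogonal_decomp[OF fs(1)] by blast
    have W': "u \<in> W" "y - u \<in> W" using u True W subspace_diff by (auto simp: nondeg_def)
    have "\<sigma> (y - u) = y - u" "\<tau> (y - u) = y - u"
      using fs(2)[OF W'(2)] ft(2)[OF W'(2)] u eq by auto
    moreover have "\<sigma> u = - u" "\<tau> u = - u" using u eq by auto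
    moreover have "\<sigma> (u + (y - u)) = \<sigma> u + \<sigma> (y - u)" "\<tau> (u + (y - u)) = \<tau> u + \<tau> (y - u)"
      using W' s t unfolding involutions_def by blast+
    ultimately show ?thesis by simp
  qed (use s t in \<open>auto simp: involutions_def\<close>)
qed

lemma card_involutions:
  assumes W: "nondeg W" and two: "(2::'a) \<noteq> 0"
  shows "card (involutions W) = card {U. nondeg U \<and> U \<subseteq> W}"
proof (rule bij_betw_same_card)
  show "bij_betw (\<lambda>\<sigma>. {v\<in>W. \<sigma> v = - v}) (involutions W) {U. nondeg U \<and> U \<subseteq> W}"
    unfolding bij_betw_def
  proof
    show "inj_on (\<lambda>\<sigma>. {v\<in>W. \<sigma> v = - v}) (involutions W)"
      by (rule inj_onI) (rule involution_eqI[OF W two])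
    show "(\<lambda>\<sigma>. {v\<in>W. \<sigma> v = - v}) ` involutions W = {U. nondeg U \<and> U \<subseteq> W}"
    proof (intro equalityI subsetI)
      fix U assume "U \<in> {U. nondeg U \<and> U \<subseteq> W}"
      then show "U \<in> (\<lambda>\<sigma>. {v\<in>W. \<sigma> v = - v}) ` involutions W"
        using involution_with_minus_space[OF W two] by fast
    qed (use involution_facts(1)[OF W two] in auto)
  qed
qed

end

section \<open>From matrices and coordinate vectors to functions on the naturals\<close>

definition fun_of_vec :: "'a::zero Matrix.vec \<Rightarrow> nat \<Rightarrow> 'a" where
  "fun_of_vec v = (\<lambda>i. if i < dim_vec v then v $ i else 0)"

text \<open>Coordinate vectors of all lengths share one type, which has no common zero and is no
  additive group. Functions form a group, and those vanishing from index d on are a copy of F^d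
  inside it.\<close>

definition fun_space :: "nat \<Rightarrow> (nat \<Rightarrow> 'a::zero) set" where
  "fun_space d = {x. \<forall>i\<ge>d. x i = 0}"

lemma fun_of_vec_mem: "v \<in> carrier_vec d \<Longrightarrow> fun_of_vec v \<in> fun_space d"
  by (auto simp: fun_of_vec_def fun_space_def)

lemma vec_fun_of_vec: "v \<in> carrier_vec d \<Longrightarrow> Matrix.vec d (fun_of_vec v) = v"
  by (intro eq_vecI) (auto simp: fun_of_vec_def)

lemma fun_of_vec_vec: "x \<in> fun_space d \<Longrightarrow> fun_of_vec (Matrix.vec d x) = x"
  by (rule ext) (auto simp: fun_of_vec_def fun_space_def)

lemma vec_add: "Matrix.vec d (x + y) = Matrix.vec d x + Matrix.vec d y"
  by (rule eq_vecI) auto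

lemma vec_scale: "Matrix.vec d (\<lambda>i. c * x i) = c \<cdot>\<^sub>v Matrix.vec d x"
  by (rule eq_vecI) auto

lemma fun_of_vec_add:
  fixes u v :: "'a::monoid_add Matrix.vec"
  shows
  "u \<in> carrier_vec d \<Longrightarrow> v \<in> carrier_vec d \<Longrightarrow> fun_of_vec (u + v) = fun_of_vec u + fun_of_vec v"
  by (rule ext) (auto simp: fun_of_vec_def)

lemma fun_of_vec_smult:
  fixes v :: "'a::semiring_0 Matrix.vec"
  shows "fun_of_vec (c \<cdot>\<^sub>v v) = (\<lambda>i. c * fun_of_vec v i)"
  by (rule ext) (auto simp: fun_of_vec_def)

lemma card_fun_space: "finite (fun_space d :: (nat \<Rightarrow> 'a::{zero,finite}) set)"
  "card (fun_space d :: (nat \<Rightarrow> 'a) set) = CARD('a) ^ d"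
proof -
  have bij: "bij_betw (\<lambda>x i. if i < d then x i else 0) ({..<d} \<rightarrow>\<^sub>E UNIV) (fun_space d :: (nat \<Rightarrow> 'a) set)"
    by (rule bij_betw_byWitness[where f' = "\<lambda>x. restrict x {..<d}"])
      (auto simp: fun_space_def fun_eq_iff PiE_def extensional_def)
  show "finite (fun_space d :: (nat \<Rightarrow> 'a) set)"
    using bij_betw_finite[OF bij] by (simp add: finite_PiE)
  show "card (fun_space d :: (nat \<Rightarrow> 'a) set) = CARD('a) ^ d"
    using bij_betw_same_card[OF bij] by (simp add: card_PiE)
qed

lemma sum_fun_apply: "sum f A i = (\<Sum>a\<in>A. f a i)"
  by (induction A rule: infinite_finite_induct) auto

lemma mat_eqI_mult_vec:
  fixes g h :: "'a::comm_semiring_1 mat"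
  assumes g: "g \<in> carrier_mat d d" and h: "h \<in> carrier_mat d d"
    and eq: "\<And>v. v \<in> carrier_vec d \<Longrightarrow> g *\<^sub>v v = h *\<^sub>v v"
  shows "g = h"
proof (rule eq_matI)
  fix i j assume ij: "i < dim_row h" "j < dim_col h"
  then have ij: "i < d" "j < d" using h by auto
  have "(g *\<^sub>v unit_vec d j) $ i = (h *\<^sub>v unit_vec d j) $ i"
    using eq[of "unit_vec d j"] by simp
  then show "g $$ (i, j) = h $$ (i, j)" using g h ij by simp
qed (use g h in auto)

lemma vector_space_fun: "vector_space (\<lambda>c (x :: 'i \<Rightarrow> 'a::field) i. c * x i)"
  by unfold_locales (auto simp: fun_eq_iff algebra_simps)

lemma symplectic_fun_space:
  fixes B :: "'a::{field,finite} Matrix.vec \<Rightarrow> 'a Matrix.vec \<Rightarrow> 'a"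
  assumes B: "symplectic_form d B"
  defines "B' \<equiv> \<lambda>x y. B (Matrix.vec d x) (Matrix.vec d y)"
  defines "sc \<equiv> \<lambda>c (x :: nat \<Rightarrow> 'a) i. c * x i"
  shows "alternating_space sc B'" and "alternating_space.nondeg sc B' (fun_space d)"
proof -
  interpret vector_space sc unfolding sc_def by (rule vector_space_fun)
  interpret alternating_space sc B'
    using B by unfold_locales
      (simp_all add: B'_def sc_def vec_add vec_scale symplectic_form_def bilinear_form_def alternating_form_def)
  show "alternating_space sc B'" by unfold_locales
  have "x = 0" if x: "x \<in> fun_space d" "\<forall>y\<in>fun_space d. B' x y = 0" for x
  proof -
    have "B (Matrix.vec d x) w = 0" if "w \<in> carrier_vec d" for w
      using x(2) fun_of_vec_mem[OF that] vec_fun_of_vec[OF that] unfolding B'_def by metis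
    then have "Matrix.vec d x = 0\<^sub>v d"
      using B by (auto simp: symplectic_form_def nondegenerate_form_def)
    then have "x = fun_of_vec (0\<^sub>v d)" using fun_of_vec_vec[OF x(1)] by simp
    then show ?thesis by (auto simp: fun_of_vec_def fun_eq_iff)
  qed
  moreover have "subspace (fun_space d)" unfolding subspace_def by (auto simp: fun_space_def sc_def)
  ultimately show "nondeg (fun_space d)" using card_fun_space(1) by (auto simp: nondeg_def)
qed

text \<open>The bijection sends a matrix to its action on \<open>fun_space d\<close>; it is
  injective because vectors separate matrices, and surjective because an involution is linear and so
  has a matrix.\<close>

lemma i_Sp_eq_card_involutions:
  fixes B :: "'a::{field,finite} Matrix.vec \<Rightarrow> 'a Matrix.vec \<Rightarrow> 'a"
  assumes B: "symplectic_form d B"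
  shows "i_Sp d B = card (alternating_space.involutions (\<lambda>c (x :: nat \<Rightarrow> 'a) i. c * x i)
     (\<lambda>x y. B (Matrix.vec d x) (Matrix.vec d y)) (fun_space d))"
proof -
  let ?sc = "\<lambda>c (x :: nat \<Rightarrow> 'a) i. c * x i"
  let ?W = "fun_space d :: (nat \<Rightarrow> 'a) set"
  let ?vec = "Matrix.vec d :: (nat \<Rightarrow> 'a) \<Rightarrow> 'a Matrix.vec"
  interpret alternating_space ?sc "\<lambda>x y. B (Matrix.vec d x) (Matrix.vec d y)"
    by (rule symplectic_fun_space[OF B])
  have sW: "subspace ?W" using symplectic_fun_space(2)[OF B] by (simp add: nondeg_def)
  define F where "F g = (\<lambda>x. if x \<in> ?W then fun_of_vec (g *\<^sub>v ?vec x) else 0)" for g :: "'a mat"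
  let ?G = "{g \<in> Sp d B. g * g = 1\<^sub>m d}"
  have vF: "?vec (F g x) = g *\<^sub>v ?vec x" if "g \<in> carrier_mat d d" "x \<in> ?W" for g x
    using that by (simp add: F_def vec_fun_of_vec[of _ d])
  have "inj_on F ?G"
  proof (rule inj_onI)
    fix g h assume gh: "g \<in> ?G" "h \<in> ?G" "F g = F h"
    then have c: "g \<in> carrier_mat d d" "h \<in> carrier_mat d d" by (auto simp: Sp_def)
    show "g = h"
    proof (rule mat_eqI_mult_vec[OF c])
      fix v :: "'a Matrix.vec" assume "v \<in> carrier_vec d"
      then show "g *\<^sub>v v = h *\<^sub>v v"
        using vF[OF c(1), of "fun_of_vec v"] vF[OF c(2), of "fun_of_vec v"] gh(3)
        by (simp add: fun_of_vec_mem vec_fun_of_vec)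
    qed
  qed
  moreover have "F ` ?G = involutions ?W"
  proof (intro equalityI subsetI)
    fix \<sigma> assume "\<sigma> \<in> F ` ?G"
    then obtain g where g: "g \<in> carrier_mat d d" "g * g = 1\<^sub>m d" "\<sigma> = F g"
      "\<And>v w. v \<in> carrier_vec d \<Longrightarrow> w \<in> carrier_vec d \<Longrightarrow> B (g *\<^sub>v v) (g *\<^sub>v w) = B v w"
      by (auto simp: Sp_def)
    have mem: "F g x \<in> ?W" if "x \<in> ?W" for x
      using that g(1) by (simp add: F_def fun_of_vec_mem)
    show "\<sigma> \<in> involutions ?W"
      unfolding involutions_def g(3)
    proof (intro CollectI conjI ballI allI impI)
      fix x assume x: "x \<in> ?W"
      show "F g x \<in> ?W" by (rule mem[OF x])
      have "g *\<^sub>v (g *\<^sub>v ?vec x) = ?vec x"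
        using assoc_mult_mat_vec[OF g(1) g(1), of "?vec x"] g(2) by simp
      moreover have "F g (F g x) = fun_of_vec (g *\<^sub>v ?vec (F g x))"
        using mem[OF x] by (subst F_def) simp
      ultimately show "F g (F g x) = x" using x by (simp add: vF[OF g(1) x] fun_of_vec_vec)
    next
      fix x y assume x: "x \<in> ?W" "y \<in> ?W"
      show "F g (x + y) = F g x + F g y"
        using x g(1) subspace_add[OF sW x]
        by (simp add: F_def vec_add mult_add_distrib_mat_vec[OF g(1)] fun_of_vec_add[of _ d])
      show "B (?vec (F g x)) (?vec (F g y)) = B (?vec x) (?vec y)"
        using x g by (simp add: vF)
    next
      fix c x assume x: "x \<in> ?W"
      show "F g (\<lambda>i. c * x i) = (\<lambda>i. c * F g x i)"
        using x g(1) subspace_scale[OF sW x, of c]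
        by (simp add: F_def vec_scale mult_mat_vec[OF g(1)] fun_of_vec_smult)
    qed (simp add: F_def)
  next
    fix \<sigma> assume s: "\<sigma> \<in> involutions ?W"
    have mem: "\<sigma> x \<in> ?W" "\<sigma> (\<sigma> x) = x" if "x \<in> ?W" for x
      using s that by (auto simp: involutions_def)
    have add: "\<sigma> (x + y) = \<sigma> x + \<sigma> y" "B (?vec (\<sigma> x)) (?vec (\<sigma> y)) = B (?vec x) (?vec y)"
      if "x \<in> ?W" "y \<in> ?W" for x y
      using s that by (auto simp: involutions_def)
    have scal: "\<sigma> (?sc c x) = ?sc c (\<sigma> x)" if "x \<in> ?W" for c x
      using s that unfolding involutions_def by blast
    have zero: "\<sigma> 0 = 0" using scal[of 0 0] subspace_0[OF sW] by (simp add: zero_fun_def)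
    define e :: "nat \<Rightarrow> nat \<Rightarrow> 'a" where "e j = (\<lambda>i. if i = j then 1 else 0)" for j
    have e: "e j \<in> ?W" if "j < d" for j using that by (auto simp: e_def fun_space_def)
    \<comment> \<open>Additivity of \<sigma> is known only inside the subspace, so membership of the
      partial sums is carried through the induction.\<close>
    have sum_in: "(\<Sum>j\<in>J. ?sc (c j) (e j)) \<in> ?W
        \<and> \<sigma> (\<Sum>j\<in>J. ?sc (c j) (e j)) = (\<Sum>j\<in>J. ?sc (c j) (\<sigma> (e j)))"
      if "finite J" "J \<subseteq> {..<d}" for J and c :: "nat \<Rightarrow> 'a"
      using that
    proof (induction J rule: finite_induct)
      case empty
      then show ?case using zero subspace_0[OF sW] by (simp add: zero_fun_def)
    next
      case (insert j J)
      then have "e j \<in> ?W" using e by blast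
      then have sc: "?sc (c j) (e j) \<in> ?W" "\<sigma> (?sc (c j) (e j)) = ?sc (c j) (\<sigma> (e j))"
        using subspace_scale[OF sW] scal by blast+
      have IH: "(\<Sum>j\<in>J. ?sc (c j) (e j)) \<in> ?W"
        "\<sigma> (\<Sum>j\<in>J. ?sc (c j) (e j)) = (\<Sum>j\<in>J. ?sc (c j) (\<sigma> (e j)))"
        using insert by auto
      show ?case
        unfolding sum.insert[OF insert.hyps] add(1)[OF sc(1) IH(1)] sc(2) IH(2)
        using subspace_add[OF sW sc(1) IH(1)] by blast
    qed
    have expand: "x = (\<Sum>j<d. ?sc (x j) (e j))" if "x \<in> ?W" for x
      using that by (auto simp: fun_eq_iff sum_fun_apply e_def fun_space_def if_distrib cong: if_cong)
    have s_expand: "\<sigma> x i = (\<Sum>j<d. x j * \<sigma> (e j) i)" if "x \<in> ?W" for x i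
    proof -
      have "\<sigma> x = (\<Sum>j<d. ?sc (x j) (\<sigma> (e j)))"
        using sum_in[of "{..<d}" x] expand[OF that] by simp
      then show ?thesis by (simp add: sum_fun_apply)
    qed
    \<comment> \<open>Column j is the image of the unit vector \<open>e j\<close>.\<close>
    define g where "g = mat d d (\<lambda>(i, j). \<sigma> (e j) i)"
    have g: "g \<in> carrier_mat d d" by (simp add: g_def)
    have gv: "g *\<^sub>v ?vec x = ?vec (\<sigma> x)" if "x \<in> ?W" for x
      by (rule eq_vecI)
        (auto simp: g_def scalar_prod_def s_expand[OF that] mult.commute atLeast0LessThan intro!: sum.cong)
    have Fg: "F g = \<sigma>"
    proof
      fix x show "F g x = \<sigma> x"
        using s by (auto simp: F_def gv fun_of_vec_vec mem involutions_def)
    qed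
    have gv': "g *\<^sub>v v = ?vec (\<sigma> (fun_of_vec v))" if "v \<in> carrier_vec d" for v
      using gv[OF fun_of_vec_mem[OF that]] vec_fun_of_vec[OF that] by simp
    have gg: "g * g = 1\<^sub>m d"
    proof (rule mat_eqI_mult_vec)
      fix v :: "'a Matrix.vec" assume v: "v \<in> carrier_vec d"
      have "(g * g) *\<^sub>v v = g *\<^sub>v (g *\<^sub>v v)" by (rule assoc_mult_mat_vec[OF g g v])
      also have "\<dots> = v"
        using fun_of_vec_mem[OF v] by (simp add: gv' v gv mem vec_fun_of_vec fun_of_vec_vec)
      finally show "(g * g) *\<^sub>v v = 1\<^sub>m d *\<^sub>v v" using v by simp
    qed (use g in auto)
    have "g \<in> Sp d B"
      unfolding Sp_def
    proof (intro CollectI conjI ballI)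
      show "g \<in> carrier_mat d d" by (rule g)
      show "invertible_mat g" using g gg by (auto simp: invertible_mat_def inverts_mat_def)
      fix v w :: "'a Matrix.vec" assume "v \<in> carrier_vec d" "w \<in> carrier_vec d"
      then show "B (g *\<^sub>v v) (g *\<^sub>v w) = B v w"
        by (simp add: gv' add(2) fun_of_vec_mem vec_fun_of_vec)
    qed
    then show "\<sigma> \<in> F ` ?G" using gg Fg by blast
  qed
  ultimately have "bij_betw F ?G (involutions ?W)" by (simp add: bij_betw_def)
  then show ?thesis by (simp add: i_Sp_def bij_betw_same_card)
qed

text \<open>If 2 = 0 the characteristic is 2, and the characteristic divides the order of the
  field.\<close>

lemma two_neq_zero_of_odd_card:
  assumes "odd CARD('a::{field,finite})"
  shows "(2::'a) \<noteq> 0"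
proof
  assume "(2::'a) = 0"
  then have "CHAR('a) dvd 2" by (metis of_nat_eq_0_iff_char_dvd of_nat_numeral)
  then have "CHAR('a) = 2" using CHAR_not_1 prime_nat_iff two_is_prime_nat by (metis One_nat_def)
  then show False using CHAR_dvd_CARD[where 'a='a] assms by simp
qed

theorem i_Sp_formula:
  fixes B :: "'a::{field,finite} Matrix.vec \<Rightarrow> 'a Matrix.vec \<Rightarrow> 'a"
  assumes B: "symplectic_form (2 * n) B" and odd: "odd CARD('a)"
  defines "x \<equiv> 1 / real CARD('a)"
  shows "real (i_Sp (2 * n) B)
    = (\<Sum>k\<le>n. real CARD('a) ^ (4 * k * (n - k)) * qpoch x n / (qpoch x k * qpoch x (n - k)))"
proof -
  interpret alternating_space "\<lambda>c (x :: nat \<Rightarrow> 'a) i. c * x i"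
      "\<lambda>x y. B (Matrix.vec (2 * n) x) (Matrix.vec (2 * n) y)"
    by (rule symplectic_fun_space[OF B])
  have W: "nondeg (fun_space (2 * n))" by (rule symplectic_fun_space(2)[OF B])
  show ?thesis
    unfolding i_Sp_eq_card_involutions[OF B] x_def
      card_involutions[OF W two_neq_zero_of_odd_card[OF odd]]
    by (rule card_all_nondeg_subspaces[OF W card_fun_space(2)])
qed

lemma abs_le_square: "\<bar>j\<bar> \<le> j\<^sup>2" for j :: int
proof -
  have "\<bar>j\<bar> * 1 \<le> \<bar>j\<bar> * \<bar>j\<bar>"
  proof (cases "j = 0")
    case False
    then show ?thesis by (intro mult_left_mono) auto
  qed simp
  then show ?thesis by (simp only: mult_1_right abs_mult_self_eq power2_eq_square)
qed

lemma abs_le_four_squares: "\<bar>j\<bar> \<le> 4 * j\<^sup>2 + 1" "\<bar>j\<bar> \<le> 4 * j\<^sup>2 - 4 * j + 1" for j :: int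
proof -
  show "\<bar>j\<bar> \<le> 4 * j\<^sup>2 + 1" using abs_le_square[of j] by (smt (verit) zero_le_power2)
  have "\<bar>2 * j - 1\<bar> \<le> (2 * j - 1)\<^sup>2" by (rule abs_le_square)
  moreover have "(2 * j - 1)\<^sup>2 = 4 * j\<^sup>2 - 4 * j + 1" by (simp add: power2_eq_square algebra_simps)
  \<comment> \<open>This uses that j is an integer; it fails at 1/2.\<close>
  moreover have "\<bar>j\<bar> \<le> \<bar>2 * j - 1\<bar>" by linarith
  ultimately show "\<bar>j\<bar> \<le> 4 * j\<^sup>2 - 4 * j + 1" by simp
qed

section \<open>Theta series\<close>

lemma prodinf_eq_of_LIMSEQ:
  fixes f :: "nat \<Rightarrow> real"
  shows "convergent_prod f \<Longrightarrow> (\<lambda>n. \<Prod>i<n. f i) \<longlonglongrightarrow> L \<Longrightarrow> prodinf f = L"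
  using convergent_prod_LIMSEQ_lessThan LIMSEQ_unique by blast

lemma infsetsum_image:
  fixes f :: "int \<Rightarrow> real"
  assumes "inj h" "\<And>j. j \<notin> range h \<Longrightarrow> f j = 0"
  shows "infsetsum f UNIV = infsetsum (\<lambda>j. f (h j)) UNIV"
proof -
  have "infsetsum f UNIV = infsetsum f (range h)"
    by (rule infsetsum_cong_neutral) (use assms(2) in auto)
  also have "\<dots> = infsetsum (\<lambda>j. f (h j)) UNIV"
    by (rule infsetsum_reindex_bij_betw[symmetric]) (use assms(1) in \<open>simp add: bij_betw_def\<close>)
  finally show ?thesis .
qed

context
  fixes x :: real
  assumes x: "0 < x" "x < 1"
begin

lemma theta_summable:
  assumes "\<bar>s\<bar> = 1"
  shows "Infinite_Set_Sum.abs_summable_on (\<lambda>j. x powi j\<^sup>2 * s powi j) UNIV"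
proof -
  have "Infinite_Set_Sum.abs_summable_on (\<lambda>j. x powi j\<^sup>2) UNIV"
    by (rule abs_summable_power_int[OF x]) (use abs_le_square in \<open>simp add: add_increasing2\<close>)
  then show ?thesis
    by (rule abs_summable_on_comparison_test) (simp add: abs_mult power_int_abs assms)
qed

text \<open>At z = s with s = 1/s, the two factors of the triple product coincide.\<close>

lemma prodinf_square_eq_theta:
  assumes s: "s = 1 \<or> s = - 1"
  shows "(\<Prod>i. (1 + s * x ^ (2 * i + 1))\<^sup>2) = infsetsum (\<lambda>j. x powi j\<^sup>2 * s powi j) UNIV / qpoch_inf x"
proof (rule prodinf_eq_of_LIMSEQ)
  have "convergent_prod (\<lambda>i. 1 + s * x ^ (2 * i + 1))" using x by (intro convergent_prod_power) auto
  then show "convergent_prod (\<lambda>i. (1 + s * x ^ (2 * i + 1))\<^sup>2)"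
    unfolding power2_eq_square by (intro convergent_prod_mult)
  have "\<bar>s\<bar> = 1" "s \<noteq> 0" using s by auto
  moreover have "(1 + s * x ^ (2 * i + 1)) * (1 + x ^ (2 * i + 1) / s) = (1 + s * x ^ (2 * i + 1))\<^sup>2" for i
    using s by (auto simp: power2_eq_square)
  ultimately show "(\<lambda>n. \<Prod>i<n. (1 + s * x ^ (2 * i + 1))\<^sup>2)
      \<longlonglongrightarrow> infsetsum (\<lambda>j. x powi j\<^sup>2 * s powi j) UNIV / qpoch_inf x"
    using jacobi_triple_product[OF x _ theta_summable, of s] by simp
qed

text \<open>Adding the theta series at z = 1 and z = -1 cancels the odd indices and doubles the even
  ones.\<close>

lemma half_sum_eq_theta:
  "1 / 2 * ((\<Prod>i. (1 + x ^ (2 * i + 1))\<^sup>2) + (\<Prod>i. (1 - x ^ (2 * i + 1))\<^sup>2))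
    = infsetsum (\<lambda>j. x powi (4 * j\<^sup>2)) UNIV / qpoch_inf x"
proof -
  let ?t = "\<lambda>s j. x powi j\<^sup>2 * s powi j"
  have "infsetsum (?t 1) UNIV + infsetsum (?t (- 1)) UNIV = infsetsum (\<lambda>j. ?t 1 j + ?t (- 1) j) UNIV"
    by (intro infsetsum_add[symmetric] theta_summable) auto
  also have "\<dots> = infsetsum (\<lambda>j. ?t 1 (2 * j) + ?t (- 1) (2 * j)) UNIV"
    by (rule infsetsum_image) (auto simp: inj_def power_int_minus_left image_iff elim!: evenE)
  also have "\<dots> = infsetsum (\<lambda>j. 2 * x powi (4 * j\<^sup>2)) UNIV"
    by (simp add: power_int_minus_left power_mult_distrib)
  also have "\<dots> = 2 * infsetsum (\<lambda>j. x powi (4 * j\<^sup>2)) UNIV"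
    by (intro infsetsum_cmult_right abs_summable_power_int[OF x] abs_le_four_squares)
  finally show ?thesis
    using prodinf_square_eq_theta[of 1] prodinf_square_eq_theta[of "- 1"]
    by (simp add: add_divide_distrib[symmetric])
qed

text \<open>Here the odd indices survive. From (2j-1)^2 = 1 + (4j^2 - 4j) a factor x comes out,
  which later cancels the q in q/2.\<close>

lemma half_diff_eq_theta:
  "1 / 2 * ((\<Prod>i. (1 + x ^ (2 * i + 1))\<^sup>2) - (\<Prod>i. (1 - x ^ (2 * i + 1))\<^sup>2))
    = x * (infsetsum (\<lambda>j. x powi (4 * j\<^sup>2 - 4 * j)) UNIV / qpoch_inf x)"
proof -
  let ?t = "\<lambda>s j. x powi j\<^sup>2 * s powi j"
  have odd: "j \<in> range (\<lambda>j. 2 * j - 1)" if "odd j" for j :: int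
    using that by (auto elim!: oddE intro!: image_eqI[of _ _ "(j + 1) div 2"])
  have sq: "x powi (2 * j - 1)\<^sup>2 = x * x powi (4 * j\<^sup>2 - 4 * j)" for j
  proof -
    have "(2 * j - 1)\<^sup>2 = 1 + (4 * j\<^sup>2 - 4 * j)" by (simp add: power2_eq_square algebra_simps)
    then show ?thesis using x by (simp only: power_int_add power_int_1_right less_imp_neq[symmetric] disj_not1 simp_thms)
  qed
  have "infsetsum (?t 1) UNIV - infsetsum (?t (- 1)) UNIV = infsetsum (\<lambda>j. ?t 1 j - ?t (- 1) j) UNIV"
    by (intro infsetsum_diff[symmetric] theta_summable) auto
  also have "\<dots> = infsetsum (\<lambda>j. ?t 1 (2 * j - 1) - ?t (- 1) (2 * j - 1)) UNIV"
    by (rule infsetsum_image) (use odd in \<open>force simp: inj_def power_int_minus_left\<close>)+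
  also have "\<dots> = infsetsum (\<lambda>j. 2 * x * x powi (4 * j\<^sup>2 - 4 * j)) UNIV"
    by (simp add: power_int_minus_left sq mult.assoc)
  also have "\<dots> = 2 * x * infsetsum (\<lambda>j. x powi (4 * j\<^sup>2 - 4 * j)) UNIV"
    by (intro infsetsum_cmult_right abs_summable_power_int[OF x] abs_le_four_squares)
  finally show ?thesis
    using prodinf_square_eq_theta[of 1] prodinf_square_eq_theta[of "- 1"]
    by (simp add: diff_divide_distrib[symmetric])
qed

end

section \<open>Product forms of the even and odd theta series\<close>

lemma power_int_power4: "(x ^ 4) powi k = x powi (4 * k)" for x :: real
  by (simp add: power_int_mult)

lemma qpoch_inf_power4: "qpoch_inf (x ^ 4) = (\<Prod>i. 1 - x ^ (8 * Suc i))"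
  unfolding qpoch_inf_def by (rule prodinf_cong) (simp only: power_mult[symmetric] mult.assoc[symmetric], simp)

context
  fixes x :: real
  assumes x: "0 < x" "x < 1"
begin

lemma power4: "0 < x ^ 4" "x ^ 4 < 1"
  using x power_strict_mono[of x 1 4] by auto

lemma convergent_prods:
  "convergent_prod (\<lambda>i. 1 + x ^ (8 * i + 4))"
  "convergent_prod (\<lambda>i. 1 + x ^ (8 * i))"
  "convergent_prod (\<lambda>i. 1 + x ^ (8 * Suc i))"
  "convergent_prod (\<lambda>i. 1 - x ^ (8 * Suc i))"
  using convergent_prod_power[of x 8 1 4] convergent_prod_power[of x 8 1 0]
    convergent_prod_power[of x 8 1 8] convergent_prod_power[of x 8 "- 1" 8] x
  by (simp_all add: add.commute)

text \<open>The triple product once more, with x^4 in place of x and z = 1; its denominator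
  \<open>qpoch_inf (x ^ 4)\<close> supplies the factors 1 - x^(8i).\<close>

lemma theta_even_product:
  "infsetsum (\<lambda>j. x powi (4 * j\<^sup>2)) UNIV / qpoch_inf x
    = (\<Prod>i. (1 + x ^ (8 * i + 4))\<^sup>2 * (1 - x ^ (8 * Suc i)) / (1 - x ^ (2 * Suc i)))"
proof -
  have conv: "convergent_prod (\<lambda>i. (1 + x ^ (8 * i + 4))\<^sup>2)"
    unfolding power2_eq_square by (intro convergent_prod_mult convergent_prods)
  have "1 * (x ^ 4) ^ (2 * i + 1) = x ^ (8 * i + 4)" for i
    by (simp only: power_mult[symmetric] mult_1_left) (simp add: add.commute)
  then have "(\<Prod>i. (1 + x ^ (8 * i + 4))\<^sup>2) = infsetsum (\<lambda>j. x powi (4 * j\<^sup>2)) UNIV / qpoch_inf (x ^ 4)"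
    using prodinf_square_eq_theta[OF power4, of 1] by (simp add: power_int_power4)
  then have eq: "infsetsum (\<lambda>j. x powi (4 * j\<^sup>2)) UNIV
      = (\<Prod>i. (1 + x ^ (8 * i + 4))\<^sup>2) * (\<Prod>i. 1 - x ^ (8 * Suc i))"
    using qpoch_inf_pos[OF power4] unfolding qpoch_inf_power4 by (simp add: field_simps)
  show ?thesis
    unfolding eq qpoch_inf_def prodinf_mult[OF conv convergent_prods(4)]
    by (intro prodinf_divide convergent_prod_mult conv convergent_prods convergent_qpoch[OF x])
qed

text \<open>The triple product with y = x^4 and z = 1/y, so that y^(j^2) z^j = x^(4j^2 - 4j). This
  shift of z yields the factors 1 + y^(2i) and 1 + y^(2i+2).\<close>

lemma theta_odd_product:
  "infsetsum (\<lambda>j. x powi (4 * j\<^sup>2 - 4 * j)) UNIV / qpoch_inf x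
    = 2 * (\<Prod>i. (1 + x ^ (8 * Suc i)) * (1 - x ^ (16 * Suc i)) / (1 - x ^ (2 * Suc i)))"
proof -
  let ?y = "x ^ 4"
  have x0: "x \<noteq> 0" using x by simp
  have summand: "?y powi j\<^sup>2 * inverse ?y powi j = x powi (4 * j\<^sup>2 - 4 * j)" for j
    using x0 by (simp only: power_int_inverse power_int_power4 power_int_diff divide_inverse disj_not1 simp_thms)
  have factors: "(1 + inverse ?y * ?y ^ (2 * i + 1)) * (1 + ?y ^ (2 * i + 1) / inverse ?y)
      = (1 + x ^ (8 * i)) * (1 + x ^ (8 * Suc i))" for i
  proof -
    have f1: "inverse ?y * ?y ^ (2 * i + 1) = ?y ^ (2 * i)" using x0 by simp
    have f2: "?y ^ (2 * i + 1) / inverse ?y = ?y ^ (2 * Suc i)" using x0 by (simp add: divide_inverse mult_ac)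
    have f3: "?y ^ (2 * k) = x ^ (8 * k)" for k
      by (simp only: power_mult[symmetric] mult.assoc[symmetric]) simp
    show ?thesis unfolding f1 f2 f3 ..
  qed
  let ?R = "\<Prod>i. 1 + x ^ (8 * Suc i)"
  let ?Q = "\<Prod>i. 1 - x ^ (8 * Suc i)"
  have "(\<Prod>i. (1 + x ^ (8 * i)) * (1 + x ^ (8 * Suc i)))
      = infsetsum (\<lambda>j. x powi (4 * j\<^sup>2 - 4 * j)) UNIV / qpoch_inf ?y"
  proof (rule prodinf_eq_of_LIMSEQ)
    show "convergent_prod (\<lambda>i. (1 + x ^ (8 * i)) * (1 + x ^ (8 * Suc i)))"
      by (intro convergent_prod_mult convergent_prods)
    have "Infinite_Set_Sum.abs_summable_on (\<lambda>j. x powi (4 * j\<^sup>2 - 4 * j)) UNIV"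
      by (intro abs_summable_power_int[OF x] abs_le_four_squares)
    then show "(\<lambda>n. \<Prod>i<n. (1 + x ^ (8 * i)) * (1 + x ^ (8 * Suc i)))
      \<longlonglongrightarrow> infsetsum (\<lambda>j. x powi (4 * j\<^sup>2 - 4 * j)) UNIV / qpoch_inf ?y"
      using jacobi_triple_product[OF power4, of "inverse ?y"] x0
      unfolding summand factors by simp
  qed
  moreover have "(\<Prod>i. (1 + x ^ (8 * i)) * (1 + x ^ (8 * Suc i))) = 2 * ?R * ?R"
  proof -
    \<comment> \<open>The leading 2 of the formula is the factor 1 + x^0 at i = 0.\<close>
    have "(\<Prod>i. 1 + x ^ (8 * i)) = 2 * ?R"
      using prodinf_split_head[OF convergent_prods(2)] by simp
    then show ?thesis by (simp only: prodinf_mult[OF convergent_prods(2,3), symmetric])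
  qed
  ultimately have eq: "infsetsum (\<lambda>j. x powi (4 * j\<^sup>2 - 4 * j)) UNIV = 2 * (?R * (?R * ?Q))"
    using qpoch_inf_pos[OF power4] unfolding qpoch_inf_power4 by (simp add: field_simps)
  \<comment> \<open>One of the two copies of \<open>?R\<close> merges with \<open>?Q\<close> into
    the product of the 1 - x^(16i).\<close>
  have "(1 + x ^ (8 * Suc i)) * (1 - x ^ (8 * Suc i)) = 1 - x ^ (16 * Suc i)" for i
  proof -
    have "x ^ (16 * Suc i) = x ^ (8 * Suc i) * x ^ (8 * Suc i)" by (simp flip: power_add)
    then show ?thesis by (simp add: algebra_simps)
  qed
  then have RQ: "?R * ?Q = (\<Prod>i. 1 - x ^ (16 * Suc i))" "convergent_prod (\<lambda>i. 1 - x ^ (16 * Suc i))"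
    using prodinf_mult[OF convergent_prods(3,4)] convergent_prod_mult[OF convergent_prods(3,4)] by simp_all
  let ?A = "\<lambda>i. (1 + x ^ (8 * Suc i)) * (1 - x ^ (16 * Suc i))"
  have "prodinf ?A / (\<Prod>i. 1 - x ^ (2 * Suc i)) = (\<Prod>i. ?A i / (1 - x ^ (2 * Suc i)))"
    by (intro prodinf_divide convergent_prod_mult convergent_prods RQ convergent_qpoch[OF x])
  then show ?thesis
    unfolding eq RQ(1) qpoch_inf_def prodinf_mult[OF convergent_prods(3) RQ(2)]
    by (simp only: times_divide_eq_right[symmetric])
qed

end

section \<open>Limits along even and odd n\<close>

lemma tendsto_residue_class:
  fixes f :: "nat \<Rightarrow> 'b::topological_space"
  assumes lim: "(\<lambda>m. f (2 * m + r)) \<longlonglongrightarrow> L" and S: "\<And>n. n \<in> S \<Longrightarrow> n = 2 * (n div 2) + r"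
  shows "(f \<longlongrightarrow> L) (inf sequentially (principal S))"
proof -
  have "filterlim (\<lambda>n::nat. n div 2) sequentially sequentially"
    unfolding filterlim_at_top
  proof
    fix Z :: nat
    show "\<forall>\<^sub>F n in sequentially. Z \<le> n div 2"
      using eventually_ge_at_top[of "2 * Z"] by eventually_elim auto
  qed
  \<comment> \<open>Replacing m by n div 2 gives a sequence in n that agrees with f on S.\<close>
  then have "(\<lambda>n. f (2 * (n div 2) + r)) \<longlonglongrightarrow> L" by (rule filterlim_compose[OF lim])
  then have "((\<lambda>n. f (2 * (n div 2) + r)) \<longlongrightarrow> L) (inf sequentially (principal S))"
    by (rule tendsto_mono[OF inf_le1])
  moreover have "\<forall>\<^sub>F n in inf sequentially (principal S). f (2 * (n div 2) + r) = f n"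
    unfolding eventually_inf_principal using S by (auto intro!: always_eventually)
  ultimately show ?thesis by (rule Lim_transform_eventually)
qed

text \<open>The normalising exponent a is n^2 or n^2 - 1. The exponent e is a parameter so that it
  can be supplied already recentred, as a function of k - m.\<close>

lemma i_Sp_div_power:
  fixes B :: "'a::{field,finite} Matrix.vec \<Rightarrow> 'a Matrix.vec \<Rightarrow> 'a"
  assumes B: "symplectic_form (2 * n) B" and q: "CARD('a) = q" "odd q"
    and e: "\<And>k. k \<le> n \<Longrightarrow> e k = int a - 4 * int k * (int n - int k)"
  shows "real (i_Sp (2 * n) B) / real q ^ a = (\<Sum>k\<le>n. (1 / real q) powi e k * qbinom (1 / real q) n k)"
proof -
  have q0: "real q \<noteq> 0" using q(2) by (auto intro: Nat.gr0I)
  have summand: "(1 / real q) powi e k = real q ^ (4 * k * (n - k)) / real q ^ a" if "k \<le> n" for k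
  proof -
    have e': "e k = int a - int (4 * k * (n - k))" using e[OF that] that by (simp add: of_nat_diff)
    have "(1 / real q) powi e k = real q powi (int (4 * k * (n - k)) - int a)"
      unfolding e' by (simp only: inverse_eq_divide[symmetric] power_int_inverse power_int_minus[symmetric] minus_diff_eq)
    also have "\<dots> = real q ^ (4 * k * (n - k)) / real q ^ a"
      using q0 by (simp only: power_int_diff power_int_of_nat disj_not1 simp_thms)
    finally show ?thesis .
  qed
  have "real (i_Sp (2 * n) B) = (\<Sum>k\<le>n. real q ^ (4 * k * (n - k)) * qbinom (1 / real q) n k)"
    unfolding i_Sp_formula[OF B q(2)[folded q(1)]] q(1) by (rule sum.cong) (simp_all add: qbinom_def)
  then show ?thesis by (simp add: sum_divide_distrib summand)
qed

theorem theorem4p2: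
  fixes q :: nat
    and B :: "nat \<Rightarrow> 'a::{field,finite} Matrix.vec \<Rightarrow> 'a Matrix.vec \<Rightarrow> 'a"
  assumes "primepow q" and "odd q"
    and "CARD('a) = q"
    and "\<And>n. symplectic_form (2 * n) (B n)"
  shows
    "((\<lambda>n. real (i_Sp (2 * n) (B n)) / real q ^ (n\<^sup>2)) \<longlongrightarrow>
        1 / 2 * ((\<Prod>i. (1 + 1 / real q ^ (2 * Suc i - 1))\<^sup>2)
               + (\<Prod>i. (1 - 1 / real q ^ (2 * Suc i - 1))\<^sup>2)))
      (inf sequentially (principal {n. even n}))
     \<and> 1 / 2 * ((\<Prod>i. (1 + 1 / real q ^ (2 * Suc i - 1))\<^sup>2)
               + (\<Prod>i. (1 - 1 / real q ^ (2 * Suc i - 1))\<^sup>2))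
       = (\<Prod>i. (1 + real q powi (4 - 8 * int (Suc i)))\<^sup>2 * (1 - real q powi (- 8 * int (Suc i)))
              / (1 - real q powi (- 2 * int (Suc i))))
     \<and> ((\<lambda>n. real (i_Sp (2 * n) (B n)) / real q ^ (n\<^sup>2 - 1)) \<longlongrightarrow>
        real q / 2 * ((\<Prod>i. (1 + 1 / real q ^ (2 * Suc i - 1))\<^sup>2)
                    - (\<Prod>i. (1 - 1 / real q ^ (2 * Suc i - 1))\<^sup>2)))
      (inf sequentially (principal {n. odd n}))
     \<and> real q / 2 * ((\<Prod>i. (1 + 1 / real q ^ (2 * Suc i - 1))\<^sup>2)
                    - (\<Prod>i. (1 - 1 / real q ^ (2 * Suc i - 1))\<^sup>2))
       = 2 * (\<Prod>i. (1 + real q powi (- 8 * int (Suc i))) * (1 - real q powi (- 16 * int (Suc i)))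
                  / (1 - real q powi (- 2 * int (Suc i))))"
proof -
  define x where "x = 1 / real q"
  have "q \<noteq> 0" "q \<noteq> 1" using assms(1,2) primepow_gt_Suc_0[of q] by auto
  then have "real q > 1" by linarith
  then have x: "0 < x" "x < 1" and qx: "real q * x = 1" by (simp_all add: x_def)
  have inv: "1 / real q ^ (2 * Suc i - 1) = x ^ (2 * i + 1)" for i
    by (simp add: x_def power_one_over)
  have pow: "real q powi (- int k) = x ^ k" for k
    by (simp add: x_def power_int_minus power_one_over inverse_eq_divide)
  \<comment> \<open>The products start at i = 0, so the i of the formulas is \<open>Suc i\<close>;
    thus 4 - 8(i+1) = -(8i + 4).\<close>
  have pows: "real q powi (4 - 8 * int (Suc i)) = x ^ (8 * i + 4)"
    "real q powi (- 2 * int (Suc i)) = x ^ (2 * Suc i)"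
    "real q powi (- 8 * int (Suc i)) = x ^ (8 * Suc i)"
    "real q powi (- 16 * int (Suc i)) = x ^ (16 * Suc i)" for i
    unfolding pow[symmetric] by (rule arg_cong[where f = "power_int (real q)"], simp)+
  let ?E = "infsetsum (\<lambda>j. x powi (4 * j\<^sup>2)) UNIV / qpoch_inf x"
  let ?O = "infsetsum (\<lambda>j. x powi (4 * j\<^sup>2 - 4 * j)) UNIV / qpoch_inf x"
  have E: "1 / 2 * ((\<Prod>i. (1 + x ^ (2 * i + 1))\<^sup>2) + (\<Prod>i. (1 - x ^ (2 * i + 1))\<^sup>2)) = ?E"
    by (rule half_sum_eq_theta[OF x])
  have O: "real q / 2 * ((\<Prod>i. (1 + x ^ (2 * i + 1))\<^sup>2) - (\<Prod>i. (1 - x ^ (2 * i + 1))\<^sup>2)) = ?O"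
  proof -
    have "real q / 2 * ((\<Prod>i. (1 + x ^ (2 * i + 1))\<^sup>2) - (\<Prod>i. (1 - x ^ (2 * i + 1))\<^sup>2))
        = real q * (1 / 2 * ((\<Prod>i. (1 + x ^ (2 * i + 1))\<^sup>2) - (\<Prod>i. (1 - x ^ (2 * i + 1))\<^sup>2)))"
      by simp
    also have "\<dots> = ?O" unfolding half_diff_eq_theta[OF x] using qx by (simp only: mult.assoc[symmetric] mult_1_left)
    finally show ?thesis .
  qed
  have even_lim: "((\<lambda>n. real (i_Sp (2 * n) (B n)) / real q ^ (n\<^sup>2)) \<longlongrightarrow> ?E)
      (inf sequentially (principal {n. even n}))"
  proof (rule tendsto_residue_class[where r = 0])
    \<comment> \<open>Here (2m)^2 - 4k(2m-k) = 4(k-m)^2. The \<open>+ 0\<close> keeps the shape 2m +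
      r of the limit lemmas.\<close>
    have "real (i_Sp (2 * (2 * m + 0)) (B (2 * m + 0))) / real q ^ (2 * m + 0)\<^sup>2
        = (\<Sum>k\<le>2 * m + 0. x powi (4 * (int k - int m)\<^sup>2) * qbinom x (2 * m + 0) k)" for m
      unfolding x_def
      by (rule i_Sp_div_power[OF assms(4,3,2)]) (simp add: of_nat_diff power2_eq_square algebra_simps)
    then show "(\<lambda>m. real (i_Sp (2 * (2 * m + 0)) (B (2 * m + 0))) / real q ^ (2 * m + 0)\<^sup>2) \<longlonglongrightarrow> ?E"
      by (simp only: tendsto_sum_qbinom[OF x abs_summable_power_int[OF x abs_le_four_squares(1)]])
  qed auto
  have odd_lim: "((\<lambda>n. real (i_Sp (2 * n) (B n)) / real q ^ (n\<^sup>2 - 1)) \<longlongrightarrow> ?O)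
      (inf sequentially (principal {n. odd n}))"
  proof (rule tendsto_residue_class[where r = 1])
    \<comment> \<open>Here (2m+1)^2 - 1 - 4k(2m+1-k) = 4j^2 - 4j with j = k - m.\<close>
    have "real (i_Sp (2 * (2 * m + 1)) (B (2 * m + 1))) / real q ^ ((2 * m + 1)\<^sup>2 - 1)
        = (\<Sum>k\<le>2 * m + 1. x powi (4 * (int k - int m)\<^sup>2 - 4 * (int k - int m)) * qbinom x (2 * m + 1) k)" for m
      unfolding x_def
      by (rule i_Sp_div_power[OF assms(4,3,2)]) (simp add: of_nat_diff power2_eq_square algebra_simps)
    then show "(\<lambda>m. real (i_Sp (2 * (2 * m + 1)) (B (2 * m + 1))) / real q ^ ((2 * m + 1)\<^sup>2 - 1)) \<longlonglongrightarrow> ?O"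
      by (simp only: tendsto_sum_qbinom[OF x abs_summable_power_int[OF x abs_le_four_squares(2)]])
  qed auto
  show ?thesis
    unfolding inv pows E O
    using even_lim odd_lim theta_even_product[OF x] theta_odd_product[OF x] by blast
qed

end
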